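(* Let $M$ be a finite dimensional $kE$-module, $1\le r\le n$, and $1\le\ell\le r(p-1)$. There is a unique subsheaf $\mathcal{K}er^\ell(M)\subset M\otimes\mathcal O_{Gr}$ (of $\mathcal O_{Gr}$-modules) whose restriction to $\mathcal U_\Sigma$ equals $\operatorname{Ker}^\ell(M)_{\mathcal U_\Sigma}$ for each subset $\Sigma\subset\{1,\dots,n\}$ of cardinality $r$. Similarly, there is a unique subsheaf $\mathcal{I}m^\ell(M)\subset M\otimes\mathcal O_{Gr}$ whose restriction to $\mathcal U_\Sigma$ equals $\operatorname{Im}^\ell(M)_{\mathcal U_\Sigma}$ for each subset $\Sigma\subset\{1,\dots,n\}$ of cardinality $r$.
   Context: $k$ is an algebraically closed field of characteristic $p>0$, $E$ an elementary abelian $p$-group of rank $n\ge1$, $\mathbb V\subset\operatorname{Rad}(kE)$ a linear subspace with basis $x_1,\dots,x_n$ such that $\mathbb V\hookrightarrow\operatorname{Rad}(kE)\to\operatorname{Rad}(kE)/\operatorname{Rad}^2(kE)$ is an isomorphism; so $kE=k[x_1,\dots,x_n]/(x_i^p)$. $\operatorname{Grass}(r,\mathbb V)$ is the Grassmannian of $r$-dimensional subspaces of $\mathbb V$, with structure sheaf $\mathcal O_{Gr}$, identified via the basis with $M^o_{n,r}/\mathrm{GL}_r$, where $M^o_{n,r}$ is the variety of $n\times r$ matrices of rank $r$ (a matrix represents the span of its columns). For $\Sigma=\{i_1<\dots<i_r\}\subset\{1,\dots,n\}$, $\mathcal U_\Sigma\subset\operatorname{Grass}(r,\mathbb V)$ is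 the affine open subset of those $U$ represented by matrices whose $\Sigma$-submatrix (rows indexed by $\Sigma$) is invertible; each such $U$ has a unique representative with $\Sigma$-submatrix the identity, and $k[\mathcal U_\Sigma]=k[Y^\Sigma_{i,j}]_{i\notin\Sigma,1\le j\le r}$ where $Y^\Sigma_{i,j}$ is the $(i,j)$ entry of this representative. Also put $Y^\Sigma_{i_j,j}=1$ and $Y^\Sigma_{i_{j'},j}=0$ for $j'\ne j$. For $1\le j\le r$ let $\theta^\Sigma_j:M\otimes k[\mathcal U_\Sigma]\to M\otimes k[\mathcal U_\Sigma]$ be the $k[\mathcal U_\Sigma]$-linear operator $\theta^\Sigma_j(m\otimes f)=\sum_{i=1}^n x_im\otimes Y^\Sigma_{i,j}f$. These operators commute. Define the $k[\mathcal U_\Sigma]$-submodules of $M\otimes k[\mathcal U_\Sigma]$ $$\operatorname{Ker}^\ell(M)_{\mathcal U_\Sigma}=\bigcap_{1\le j_1,\dots,j_\ell\le r}\ker(\theta^\Sigma_{j_1}\cdots\theta^\Sigma_{j_\ell}),\qquad \operatorname{Im}^\ell(M)_{\mathcal U_\Sigma}=\sum_{1\le j_1,\dots,j_\ell\le r}\operatorname{im}(\theta^\Sigma_{j_1}\cdots\theta^\Sigma_{j_\ell}),$$ identified with the corresponding coherent sheaves on the affine variety $\mathcal U_\Sigma$. *)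

theory Defs
  imports
    "HOL-Library.Poly_Mapping"
    "HOL-Library.FuncSet"
    "HOL-Computational_Algebra.Polynomial"
    "Jordan_Normal_Form.DL_Rank"
    "Jordan_Normal_Form.DL_Submatrix"
begin

section \<open>The group algebra and its modules\<close>

text \<open>
  The group algebra \<open>kE\<close> is the ring \<^typ>\<open>'e \<Rightarrow>\<^sub>0 'k\<close> of finitely supported functions with the
  convolution product; the group \<open>E\<close> is the type \<^typ>\<open>'e\<close>, written additively.  A \<open>kE\<close>-module is
  given by its scalar multiplication \<open>act\<close>, subject to \<^locale>\<open>Modules.module\<close>.
\<close>

text \<open>An elementary abelian \<open>p\<close>-group has rank \<open>n\<close> iff it has order \<open>p\<close> to the \<open>n\<close>.\<close>

definition elementary_abelian :: "'e::ab_group_add itself \<Rightarrow> nat \<Rightarrow> nat \<Rightarrow> bool" where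
  "elementary_abelian E p n \<longleftrightarrow>
     finite (UNIV :: 'e set) \<and> (\<forall>g::'e. (((+) g) ^^ p) 0 = 0) \<and> card (UNIV :: 'e set) = p ^ n"

text \<open>
  Restriction of scalars along \<open>k \<rightarrow> kE\<close>.  In particular \<open>kscale (*)\<close> is the \<open>k\<close>-vector space
  structure of \<open>kE\<close> itself.
\<close>

definition kscale ::
    "(('e::comm_monoid_add \<Rightarrow>\<^sub>0 'k::comm_ring_1) \<Rightarrow> 'm \<Rightarrow> 'm) \<Rightarrow> 'k \<Rightarrow> 'm \<Rightarrow> 'm" where
  "kscale act c m = act (Poly_Mapping.single 0 c) m"

text \<open>Ideals of a commutative ring are its submodules over itself.\<close>

definition maximal_ideal :: "'a::comm_ring_1 set \<Rightarrow> bool" where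
  "maximal_ideal I \<longleftrightarrow> Modules.module.subspace (*) I \<and> I \<noteq> UNIV \<and>
     (\<forall>J. Modules.module.subspace (*) J \<and> I \<subseteq> J \<longrightarrow> J = I \<or> J = UNIV)"

definition Rad :: "'a::comm_ring_1 set" where
  "Rad = \<Inter> {I. maximal_ideal I}"

definition Rad2 :: "'a::comm_ring_1 set" where
  "Rad2 = Modules.module.span (*) {a * b | a b. a \<in> Rad \<and> b \<in> Rad}"

text \<open>
  \<open>\<V>\<close> is a linear subspace of \<open>Rad(kE)\<close> which the projection to \<open>Rad(kE)/Rad\<^sup>2(kE)\<close> maps
  isomorphically; elements of the quotient are cosets.
\<close>

definition rad_section :: "('e::ab_group_add \<Rightarrow>\<^sub>0 'k::field) set \<Rightarrow> bool" where
  "rad_section V \<longleftrightarrow> Modules.module.subspace (kscale (*)) V \<and> V \<subseteq> Rad \<and>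
     bij_betw (\<lambda>v. (+) v ` Rad2) V ((\<lambda>v. (+) v ` Rad2) ` Rad)"

text \<open>Bases are indexed by \<open>0, \<dots>, n - 1\<close>, in agreement with the row and column indices of \<^typ>\<open>'k mat\<close>.\<close>

definition indexed_basis ::
    "('e::ab_group_add \<Rightarrow>\<^sub>0 'k::field) set \<Rightarrow> nat \<Rightarrow> (nat \<Rightarrow> 'e \<Rightarrow>\<^sub>0 'k) \<Rightarrow> bool" where
  "indexed_basis V n x \<longleftrightarrow> inj_on x {..<n} \<and>
     \<not> Modules.module.dependent (kscale (*)) (x ` {..<n}) \<and>
     Modules.module.span (kscale (*)) (x ` {..<n}) = V"


section \<open>The Grassmannian as a variety\<close>

definition Grass :: "nat \<Rightarrow> ('e::ab_group_add \<Rightarrow>\<^sub>0 'k::field) set \<Rightarrow> ('e \<Rightarrow>\<^sub>0 'k) set set" where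
  "Grass r V = {U. Modules.module.subspace (kscale (*)) U \<and> U \<subseteq> V \<and>
                   Vector_Spaces.vector_space.dim (kscale (*)) U = r}"

definition full_rank :: "nat \<Rightarrow> nat \<Rightarrow> 'k::field mat set" where
  "full_rank n r = {A \<in> carrier_mat n r. vec_space.rank n A = r}"

text \<open>The subspace represented by a matrix: column \<open>j\<close> stands for the vector \<open>\<Sum>\<^sub>i A\<^sub>i\<^sub>j x\<^sub>i\<close>.\<close>

definition colspan :: "(nat \<Rightarrow> 'e::ab_group_add \<Rightarrow>\<^sub>0 'k::field) \<Rightarrow> 'k mat \<Rightarrow> ('e \<Rightarrow>\<^sub>0 'k) set" where
  "colspan x A = Modules.module.span (kscale (*))
     ((\<lambda>j. \<Sum>i<dim_row A. kscale (*) (A $$ (i, j)) (x i)) ` {..<dim_col A})"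

text \<open>The \<open>k\<close>-algebra of functions generated by a set of functions.\<close>

inductive_set fun_algebra :: "('a \<Rightarrow> 'k::comm_ring_1) set \<Rightarrow> ('a \<Rightarrow> 'k) set"
  for G :: "('a \<Rightarrow> 'k) set" where
  gen: "g \<in> G \<Longrightarrow> g \<in> fun_algebra G"
| const: "(\<lambda>_. c) \<in> fun_algebra G"
| add: "f \<in> fun_algebra G \<Longrightarrow> g \<in> fun_algebra G \<Longrightarrow> (\<lambda>a. f a + g a) \<in> fun_algebra G"
| mult: "f \<in> fun_algebra G \<Longrightarrow> g \<in> fun_algebra G \<Longrightarrow> (\<lambda>a. f a * g a) \<in> fun_algebra G"

text \<open>Polynomial functions in the entries of an \<open>n \<times> r\<close> matrix.\<close>

definition mat_poly :: "nat \<Rightarrow> nat \<Rightarrow> ('k::field mat \<Rightarrow> 'k) set" where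
  "mat_poly n r = fun_algebra {\<lambda>A. A $$ (i, j) | i j. i < n \<and> j < r}"

text \<open>The Zariski topology on the full rank matrices: complements of vanishing sets.\<close>

definition mat_open :: "nat \<Rightarrow> nat \<Rightarrow> 'k::field mat set \<Rightarrow> bool" where
  "mat_open n r Z \<longleftrightarrow> (\<exists>P \<subseteq> mat_poly n r. Z = {A \<in> full_rank n r. \<exists>f\<in>P. f A \<noteq> 0})"

text \<open>
  \<open>Grass(r, \<V>)\<close> is the quotient of the variety of full rank matrices by \<open>GL\<^sub>r\<close>: it carries
  the quotient topology, and a function on an open set \<open>W\<close> is regular iff its pullback to the
  preimage of \<open>W\<close> is regular, i.e. locally a quotient of polynomials in the entries.
\<close>

definition gr_preimage ::
    "(nat \<Rightarrow> 'e::ab_group_add \<Rightarrow>\<^sub>0 'k::field) \<Rightarrow> nat \<Rightarrow> nat \<Rightarrow> ('e \<Rightarrow>\<^sub>0 'k) set set \<Rightarrow> 'k mat set" where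
  "gr_preimage x n r W = {A \<in> full_rank n r. colspan x A \<in> W}"

definition gr_open ::
    "('e::ab_group_add \<Rightarrow>\<^sub>0 'k::field) set \<Rightarrow> (nat \<Rightarrow> 'e \<Rightarrow>\<^sub>0 'k) \<Rightarrow> nat \<Rightarrow> nat \<Rightarrow>
     ('e \<Rightarrow>\<^sub>0 'k) set set \<Rightarrow> bool" where
  "gr_open V x n r W \<longleftrightarrow> W \<subseteq> Grass r V \<and> mat_open n r (gr_preimage x n r W)"

text \<open>
  The structure sheaf.  Here and below, sections over \<open>W\<close> are functions that are \<^const>\<open>undefined\<close>
  outside of \<open>W\<close>, so that equality of sections is equality of functions.
\<close>

definition OGr ::
    "(nat \<Rightarrow> 'e::ab_group_add \<Rightarrow>\<^sub>0 'k::field) \<Rightarrow> nat \<Rightarrow> nat \<Rightarrow>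
     ('e \<Rightarrow>\<^sub>0 'k) set set \<Rightarrow> (('e \<Rightarrow>\<^sub>0 'k) set \<Rightarrow> 'k) set" where
  "OGr x n r W = {f \<in> extensional W. \<forall>A \<in> gr_preimage x n r W.
     \<exists>Z. \<exists>a \<in> mat_poly n r. \<exists>b \<in> mat_poly n r.
       mat_open n r Z \<and> A \<in> Z \<and> Z \<subseteq> gr_preimage x n r W \<and>
       (\<forall>B\<in>Z. b B \<noteq> 0 \<and> f (colspan x B) = a B / b B)}"

text \<open>The standard chart \<open>\<U>\<^sub>\<Sigma>\<close>, its coordinates \<open>Y\<^sup>\<Sigma>\<^sub>i\<^sub>j\<close> and its coordinate ring.\<close>

definition chart ::
    "('e::ab_group_add \<Rightarrow>\<^sub>0 'k::field) set \<Rightarrow> (nat \<Rightarrow> 'e \<Rightarrow>\<^sub>0 'k) \<Rightarrow> nat \<Rightarrow> nat \<Rightarrow> nat set \<Rightarrow>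
     ('e \<Rightarrow>\<^sub>0 'k) set set" where
  "chart V x n r S = {U \<in> Grass r V. \<exists>A \<in> full_rank n r.
     colspan x A = U \<and> invertible_mat (submatrix A S UNIV)}"

text \<open>
  The matrix entries include the rows in \<open>\<Sigma>\<close>, where the coordinates are the constants \<open>0\<close> and
  \<open>1\<close> of the identity matrix.
\<close>

definition Ycoord ::
    "(nat \<Rightarrow> 'e::ab_group_add \<Rightarrow>\<^sub>0 'k::field) \<Rightarrow> nat \<Rightarrow> nat \<Rightarrow> nat set \<Rightarrow> nat \<Rightarrow> nat \<Rightarrow>
     ('e \<Rightarrow>\<^sub>0 'k) set \<Rightarrow> 'k" where
  "Ycoord x n r S i j U =
     (THE A. A \<in> full_rank n r \<and> colspan x A = U \<and> submatrix A S UNIV = 1\<^sub>m r) $$ (i, j)"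

definition chart_ring ::
    "('e::ab_group_add \<Rightarrow>\<^sub>0 'k::field) set \<Rightarrow> (nat \<Rightarrow> 'e \<Rightarrow>\<^sub>0 'k) \<Rightarrow> nat \<Rightarrow> nat \<Rightarrow> nat set \<Rightarrow>
     (('e \<Rightarrow>\<^sub>0 'k) set \<Rightarrow> 'k) set" where
  "chart_ring V x n r S = (\<lambda>f. restrict f (chart V x n r S)) `
     fun_algebra {Ycoord x n r S i j | i j. i < n \<and> i \<notin> S \<and> j < r}"


section \<open>Sheaves of submodules\<close>

text \<open>
  For a ring \<open>R\<close> of \<open>k\<close>-valued functions on \<open>X\<close>, the tensor product \<open>M \<otimes>\<^sub>k R\<close> is realised as the
  \<open>M\<close>-valued functions on \<open>X\<close> that are finite sums of functions \<open>U \<mapsto> f(U) m\<close>, the latter being the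
  image of \<open>m \<otimes> f\<close>.  (The map from the tensor product to functions is injective, as one sees by
  expanding along a \<open>k\<close>-basis of \<open>M\<close>.)
\<close>

definition tensor ::
    "(('e::ab_group_add \<Rightarrow>\<^sub>0 'k::field) \<Rightarrow> 'm::ab_group_add \<Rightarrow> 'm) \<Rightarrow> 'a set \<Rightarrow> ('a \<Rightarrow> 'k) set \<Rightarrow>
     ('a \<Rightarrow> 'm) set" where
  "tensor act X R =
     {\<lambda>U\<in>X. \<Sum>t<N. kscale act (f t U) (m t) | (N::nat) f m. \<forall>t<N. f t \<in> R}"

text \<open>Subsheaves of \<open>\<O>\<^sub>G\<^sub>r\<close>-modules of \<open>M \<otimes> \<O>\<^sub>G\<^sub>r\<close>; \<open>F W\<close> is \<^const>\<open>undefined\<close> for non-open \<open>W\<close>.\<close>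

definition module_subsheaf ::
    "(('e::ab_group_add \<Rightarrow>\<^sub>0 'k::field) \<Rightarrow> 'm::ab_group_add \<Rightarrow> 'm) \<Rightarrow>
     ('e \<Rightarrow>\<^sub>0 'k) set \<Rightarrow> (nat \<Rightarrow> 'e \<Rightarrow>\<^sub>0 'k) \<Rightarrow> nat \<Rightarrow> nat \<Rightarrow>
     (('e \<Rightarrow>\<^sub>0 'k) set set \<Rightarrow> (('e \<Rightarrow>\<^sub>0 'k) set \<Rightarrow> 'm) set) \<Rightarrow> bool" where
  "module_subsheaf act V x n r F \<longleftrightarrow>
     F \<in> extensional {W. gr_open V x n r W} \<and>
     (\<forall>W. gr_open V x n r W \<longrightarrow>
        F W \<subseteq> tensor act W (OGr x n r W) \<and>
        (\<lambda>U\<in>W. 0) \<in> F W \<and>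
        (\<forall>s\<in>F W. \<forall>t\<in>F W. (\<lambda>U\<in>W. s U + t U) \<in> F W) \<and>
        (\<forall>f\<in>OGr x n r W. \<forall>s\<in>F W. (\<lambda>U\<in>W. kscale act (f U) (s U)) \<in> F W)) \<and>
     (\<forall>W W'. gr_open V x n r W \<and> gr_open V x n r W' \<and> W' \<subseteq> W \<longrightarrow>
        (\<forall>s\<in>F W. restrict s W' \<in> F W')) \<and>
     (\<forall>C t. (\<forall>W\<in>C. gr_open V x n r W \<and> t W \<in> F W) \<and>
        (\<forall>W\<in>C. \<forall>W'\<in>C. restrict (t W) (W \<inter> W') = restrict (t W') (W \<inter> W')) \<longrightarrow>
        (\<exists>!s. s \<in> F (\<Union>C) \<and> (\<forall>W\<in>C. restrict s W = t W)))"

text \<open>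
  The sheaf on \<open>\<U>\<^sub>\<Sigma>\<close> associated with a \<open>k[\<U>\<^sub>\<Sigma>]\<close>-submodule \<open>N\<close> of \<open>M \<otimes> k[\<U>\<^sub>\<Sigma>]\<close>: its sections over
  \<open>W \<subseteq> \<U>\<^sub>\<Sigma>\<close> are locally fractions \<open>a/f\<close> with \<open>a \<in> N\<close> and \<open>f \<in> k[\<U>\<^sub>\<Sigma>]\<close>.
\<close>

definition assoc_sheaf ::
    "(('e::ab_group_add \<Rightarrow>\<^sub>0 'k::field) \<Rightarrow> 'm::ab_group_add \<Rightarrow> 'm) \<Rightarrow>
     ('e \<Rightarrow>\<^sub>0 'k) set \<Rightarrow> (nat \<Rightarrow> 'e \<Rightarrow>\<^sub>0 'k) \<Rightarrow> nat \<Rightarrow> nat \<Rightarrow> nat set \<Rightarrow>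
     (('e \<Rightarrow>\<^sub>0 'k) set \<Rightarrow> 'm) set \<Rightarrow> ('e \<Rightarrow>\<^sub>0 'k) set set \<Rightarrow> (('e \<Rightarrow>\<^sub>0 'k) set \<Rightarrow> 'm) set" where
  "assoc_sheaf act V x n r S N W = {s \<in> extensional W. \<forall>U\<in>W.
     \<exists>Z. \<exists>a\<in>N. \<exists>f\<in>chart_ring V x n r S. gr_open V x n r Z \<and> U \<in> Z \<and> Z \<subseteq> W \<and>
       (\<forall>U'\<in>Z. f U' \<noteq> 0 \<and> s U' = kscale act (inverse (f U')) (a U'))}"

definition restricts_to ::
    "(('e::ab_group_add \<Rightarrow>\<^sub>0 'k::field) \<Rightarrow> 'm::ab_group_add \<Rightarrow> 'm) \<Rightarrow>
     ('e \<Rightarrow>\<^sub>0 'k) set \<Rightarrow> (nat \<Rightarrow> 'e \<Rightarrow>\<^sub>0 'k) \<Rightarrow> nat \<Rightarrow> nat \<Rightarrow>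
     (('e \<Rightarrow>\<^sub>0 'k) set set \<Rightarrow> (('e \<Rightarrow>\<^sub>0 'k) set \<Rightarrow> 'm) set) \<Rightarrow> nat set \<Rightarrow>
     (('e \<Rightarrow>\<^sub>0 'k) set \<Rightarrow> 'm) set \<Rightarrow> bool" where
  "restricts_to act V x n r F S N \<longleftrightarrow>
     (\<forall>W. gr_open V x n r W \<and> W \<subseteq> chart V x n r S \<longrightarrow> F W = assoc_sheaf act V x n r S N W)"


section \<open>The kernel and image modules on a chart\<close>

abbreviation chart_module ::
    "(('e::ab_group_add \<Rightarrow>\<^sub>0 'k::field) \<Rightarrow> 'm::ab_group_add \<Rightarrow> 'm) \<Rightarrow>
     ('e \<Rightarrow>\<^sub>0 'k) set \<Rightarrow> (nat \<Rightarrow> 'e \<Rightarrow>\<^sub>0 'k) \<Rightarrow> nat \<Rightarrow> nat \<Rightarrow> nat set \<Rightarrow>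
     (('e \<Rightarrow>\<^sub>0 'k) set \<Rightarrow> 'm) set" where
  "chart_module act V x n r S \<equiv> tensor act (chart V x n r S) (chart_ring V x n r S)"

text \<open>On \<open>s = m \<otimes> f\<close>, i.e. \<open>s(U) = f(U) m\<close>, this is \<open>\<Sum>\<^sub>i x\<^sub>i m \<otimes> Y\<^sup>\<Sigma>\<^sub>i\<^sub>j f\<close>.\<close>

definition theta ::
    "(('e::ab_group_add \<Rightarrow>\<^sub>0 'k::field) \<Rightarrow> 'm::ab_group_add \<Rightarrow> 'm) \<Rightarrow>
     ('e \<Rightarrow>\<^sub>0 'k) set \<Rightarrow> (nat \<Rightarrow> 'e \<Rightarrow>\<^sub>0 'k) \<Rightarrow> nat \<Rightarrow> nat \<Rightarrow> nat set \<Rightarrow> nat \<Rightarrow>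
     (('e \<Rightarrow>\<^sub>0 'k) set \<Rightarrow> 'm) \<Rightarrow> (('e \<Rightarrow>\<^sub>0 'k) set \<Rightarrow> 'm)" where
  "theta act V x n r S j s =
     (\<lambda>U\<in>chart V x n r S. \<Sum>i<n. kscale act (Ycoord x n r S i j U) (act (x i) (s U)))"

text \<open>\<open>theta_prod \<dots> [j\<^sub>1, \<dots>, j\<^sub>l]\<close> is the composition of the operators for \<open>j\<^sub>1, \<dots>, j\<^sub>l\<close>.\<close>

definition theta_prod ::
    "(('e::ab_group_add \<Rightarrow>\<^sub>0 'k::field) \<Rightarrow> 'm::ab_group_add \<Rightarrow> 'm) \<Rightarrow>
     ('e \<Rightarrow>\<^sub>0 'k) set \<Rightarrow> (nat \<Rightarrow> 'e \<Rightarrow>\<^sub>0 'k) \<Rightarrow> nat \<Rightarrow> nat \<Rightarrow> nat set \<Rightarrow> nat list \<Rightarrow>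
     (('e \<Rightarrow>\<^sub>0 'k) set \<Rightarrow> 'm) \<Rightarrow> (('e \<Rightarrow>\<^sub>0 'k) set \<Rightarrow> 'm)" where
  "theta_prod act V x n r S js = foldr (theta act V x n r S) js"

definition tuples :: "nat \<Rightarrow> nat \<Rightarrow> nat list set" where
  "tuples r l = {js. length js = l \<and> set js \<subseteq> {..<r}}"

definition Ker_chart ::
    "(('e::ab_group_add \<Rightarrow>\<^sub>0 'k::field) \<Rightarrow> 'm::ab_group_add \<Rightarrow> 'm) \<Rightarrow>
     ('e \<Rightarrow>\<^sub>0 'k) set \<Rightarrow> (nat \<Rightarrow> 'e \<Rightarrow>\<^sub>0 'k) \<Rightarrow> nat \<Rightarrow> nat \<Rightarrow> nat \<Rightarrow> nat set \<Rightarrow>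
     (('e \<Rightarrow>\<^sub>0 'k) set \<Rightarrow> 'm) set" where
  "Ker_chart act V x n r l S = (\<Inter>js\<in>tuples r l.
     {s \<in> chart_module act V x n r S. theta_prod act V x n r S js s = (\<lambda>U\<in>chart V x n r S. 0)})"

text \<open>The sum of the images, written as the set of sums of one element from each image.\<close>

definition Im_chart ::
    "(('e::ab_group_add \<Rightarrow>\<^sub>0 'k::field) \<Rightarrow> 'm::ab_group_add \<Rightarrow> 'm) \<Rightarrow>
     ('e \<Rightarrow>\<^sub>0 'k) set \<Rightarrow> (nat \<Rightarrow> 'e \<Rightarrow>\<^sub>0 'k) \<Rightarrow> nat \<Rightarrow> nat \<Rightarrow> nat \<Rightarrow> nat set \<Rightarrow>
     (('e \<Rightarrow>\<^sub>0 'k) set \<Rightarrow> 'm) set" where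
  "Im_chart act V x n r l S =
     {\<lambda>U\<in>chart V x n r S. \<Sum>js\<in>tuples r l. t js U | t.
        \<forall>js\<in>tuples r l. t js \<in> theta_prod act V x n r S js ` chart_module act V x n r S}"

end

theory Submission
  imports Defs
begin

text \<open>
  A section of the sheaf over \<open>W\<close> is a function that near each point of each chart is a fraction
  \<open>a/h\<close> with \<open>a\<close> in the prescribed module of that chart and \<open>h\<close> in its coordinate ring.  Such a
  sheaf restricts correctly, and is then the only one, as soon as the modules agree on overlaps of
  charts, which is a local condition.

  On an overlap, the operators \<open>\<theta>\<close> of two charts are the actions of two bases of the same subspace
  \<open>U\<close>, hence combinations of each other with regular coefficients, and so are their \<open>l\<close>-fold
  products.  For images this gives the agreement at once.  For kernels, a section on the overlap
  killed by the products in one chart is killed by those in the other; multiplying it by the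
  denominator makes it a section over the whole chart that is still killed, since it vanishes where
  the denominator does.
\<close>

section \<open>Families in vector spaces and full rank matrices\<close>

text \<open>Sections are functions on points, so the operators become, at each \<open>U\<close>,
  actions of elements of \<open>kE\<close> on \<open>M\<close>, and kernel conditions are tested
  point by point. What remains is regularity, and there the obstacle is that two descriptions have
  to be matched: \<open>OGr\<close> speaks of quotients of polynomials in matrix entries,
  \<open>assoc_sheaf\<close> of fractions over the coordinate ring of one chart. The bridge has two
  halves: substituting the normalised representative \<open>rep S U\<close> turns a matrix
  polynomial into a chart function, and Cramer's rule turns a chart function into a polynomial
  divided by a power of a minor. With both halves, fractions move between charts through
  \<open>OGr\<close>, and no transition formula between coordinate rings is computed. A second
  obstacle is that sections must lie in \<open>tensor act W (OGr x n r W)\<close>, a global finite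
  sum, while they are given only as local fractions. Coordinates in a finite basis of
  \<open>M\<close> are defined globally, and their regularity is a local matter.\<close>

lemma kscale_vector_space:
  fixes act :: "('e::ab_group_add \<Rightarrow>\<^sub>0 'k::field) \<Rightarrow> 'm::ab_group_add \<Rightarrow> 'm"
  assumes "Modules.module act"
  shows "Vector_Spaces.vector_space (kscale act)"
proof -
  interpret Modules.module act by fact
  show ?thesis
    by unfold_locales
      (simp_all add: kscale_def single_add scale_left_distrib scale_right_distrib mult_single)
qed

lemma times_vector_space: "Vector_Spaces.vector_space (kscale ((*) :: ('e::ab_group_add \<Rightarrow>\<^sub>0 'k::field) \<Rightarrow> _))"
  by (intro kscale_vector_space) (unfold_locales, auto simp: algebra_simps)

context Vector_Spaces.vector_space
begin

lemma span_family:
  assumes "finite I"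
  shows "span (b ` I) = range (\<lambda>v. \<Sum>j\<in>I. v j *s b j)"
proof
  show "range (\<lambda>v. \<Sum>j\<in>I. v j *s b j) \<subseteq> span (b ` I)"
    by (clarify, intro span_sum span_scale span_base) simp
next
  have "subspace (range (\<lambda>v. \<Sum>j\<in>I. v j *s b j))"
  proof (rule subspaceI)
    show "0 \<in> range (\<lambda>v. \<Sum>j\<in>I. v j *s b j)"
      by (rule range_eqI[of _ _ "\<lambda>_. 0"]) simp
  next
    fix y z
    assume "y \<in> range (\<lambda>v. \<Sum>j\<in>I. v j *s b j)" "z \<in> range (\<lambda>v. \<Sum>j\<in>I. v j *s b j)"
    then obtain v w where "y = (\<Sum>j\<in>I. v j *s b j)" "z = (\<Sum>j\<in>I. w j *s b j)" by auto
    then show "y + z \<in> range (\<lambda>v. \<Sum>j\<in>I. v j *s b j)"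
      by (intro range_eqI[of _ _ "\<lambda>j. v j + w j"]) (simp add: scale_left_distrib sum.distrib)
  next
    fix c y
    assume "y \<in> range (\<lambda>v. \<Sum>j\<in>I. v j *s b j)"
    then obtain v where "y = (\<Sum>j\<in>I. v j *s b j)" by auto
    then show "c *s y \<in> range (\<lambda>v. \<Sum>j\<in>I. v j *s b j)"
      by (intro range_eqI[of _ _ "\<lambda>j. c * v j"]) (simp add: scale_sum_right)
  qed
  moreover have "b ` I \<subseteq> range (\<lambda>v. \<Sum>j\<in>I. v j *s b j)"
  proof clarify
    fix i assume "i \<in> I"
    then show "b i \<in> range (\<lambda>v. \<Sum>j\<in>I. v j *s b j)"
      using assms by (intro range_eqI[of _ _ "\<lambda>j. if j = i then 1 else 0"])
        (simp add: if_distrib[of "\<lambda>c. c *s _"] cong: if_cong)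
  qed
  ultimately show "span (b ` I) \<subseteq> range (\<lambda>v. \<Sum>j\<in>I. v j *s b j)"
    by (rule span_minimal[rotated])
qed

text \<open>Independence of a set does not notice a repeated member of the family, so injectivity
  has to accompany it.\<close>

lemma independent_family:
  assumes "finite I"
  shows "inj_on b I \<and> independent (b ` I) \<longleftrightarrow>
    (\<forall>v. (\<Sum>j\<in>I. v j *s b j) = 0 \<longrightarrow> (\<forall>j\<in>I. v j = 0))" (is "?l \<longleftrightarrow> ?r")
proof
  assume l: ?l
  show ?r
  proof (intro allI impI ballI)
    fix v j assume "(\<Sum>j\<in>I. v j *s b j) = 0" "j \<in> I"
    moreover have "(\<Sum>y\<in>b ` I. v (the_inv_into I b y) *s y) = (\<Sum>j\<in>I. v j *s b j)"
      using l by (subst sum.reindex) (auto simp: the_inv_into_f_f intro!: sum.cong)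
    ultimately have "v (the_inv_into I b (b j)) = 0"
      using l assms by (intro independentD[of "b ` I" "b ` I" "\<lambda>y. v (the_inv_into I b y)"]) auto
    then show "v j = 0" using l \<open>j \<in> I\<close> by (simp add: the_inv_into_f_f)
  qed
next
  assume r: ?r
  have inj: "inj_on b I"
  proof (rule inj_onI, rule ccontr)
    fix i j assume ij: "i \<in> I" "j \<in> I" "b i = b j" "i \<noteq> j"
    have "(\<Sum>k\<in>I. ((if k = i then 1 else 0) - (if k = j then 1 else 0)) *s b k) = b i - b j"
      using ij assms by (simp add: scale_left_diff_distrib sum_subtractf
          if_distrib[of "\<lambda>c. c *s _"] cong: if_cong)
    then show False using r[rule_format, of _ i] ij by force
  qed
  moreover have "independent (b ` I)"
  proof
    assume "dependent (b ` I)"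
    then obtain u where u: "\<exists>y\<in>b ` I. u y \<noteq> 0" "(\<Sum>y\<in>b ` I. u y *s y) = 0"
      using dependent_finite[of "b ` I"] assms by auto
    then have "(\<Sum>j\<in>I. u (b j) *s b j) = 0" using inj by (simp add: sum.reindex)
    with r u(1) show False by fastforce
  qed
  ultimately show ?l by blast
qed

end

text \<open>The rank is computed from the set of columns, so each direction first rules out repeated
  columns; after that, independence of the columns is triviality of the kernel.\<close>

lemma full_rank_iff:
  "A \<in> full_rank n r \<longleftrightarrow> A \<in> carrier_mat n r \<and>
     (\<forall>v. (\<forall>i<n. (\<Sum>j<r. A $$ (i, j) * v j) = 0) \<longrightarrow> (\<forall>j<r. v j = (0::'k::field)))"
proof (cases "A \<in> carrier_mat n r")
  case False
  then show ?thesis by (auto simp: full_rank_def)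
next
  case A: True
  interpret vec_space "TYPE('k)" n .
  have inj_iff: "(\<forall>v. (\<forall>i<n. (\<Sum>j<r. A $$ (i, j) * v j) = 0) \<longrightarrow> (\<forall>j<r. v j = (0::'k))) \<longleftrightarrow>
    (\<forall>w\<in>carrier_vec r. A *\<^sub>v w = 0\<^sub>v n \<longrightarrow> w = 0\<^sub>v r)" (is "?l \<longleftrightarrow> ?r")
  proof -
    have eq: "A *\<^sub>v w = 0\<^sub>v n \<longleftrightarrow> (\<forall>i<n. (\<Sum>j<r. A $$ (i, j) * w $ j) = 0)"
      if "w \<in> carrier_vec r" for w
      using A that by (auto simp: vec_eq_iff scalar_prod_def atLeast0LessThan)
    show ?thesis
    proof
      assume ?l
      then show ?r using eq by (auto simp: vec_eq_iff)
    next
      assume r: ?r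
      show ?l
      proof (intro allI impI)
        fix v j assume "\<forall>i<n. (\<Sum>j<r. A $$ (i, j) * v j) = 0" "j < r"
        moreover have "vec r v = 0\<^sub>v r" if "\<forall>i<n. (\<Sum>j<r. A $$ (i, j) * v j) = 0"
          using r that eq[of "vec r v"] by auto
        ultimately show "v j = 0" by (metis index_vec index_zero_vec(1))
      qed
    qed
  qed
  have "rank A = r \<longleftrightarrow> (\<forall>w\<in>carrier_vec r. A *\<^sub>v w = 0\<^sub>v n \<longrightarrow> w = 0\<^sub>v r)"
  proof
    assume rank: "rank A = r"
    \<comment> \<open>The rank is the size of a maximal independent subset of the set of columns, so
      rank r leaves no room for two of the r columns to coincide.\<close>
    have "distinct (cols A)"
    proof -
      obtain S where S: "maximal S (\<lambda>T. T \<subseteq> set (cols A) \<and> lin_indpt T)"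
        using maximal_exists[of "(\<lambda>T. T \<subseteq> set (cols A) \<and> lin_indpt T)" "card (set (cols A))" "{}"]
        by (meson List.finite_set card_mono empty_iff empty_subsetI finite_lin_indpt2 rev_finite_subset)
      then have "r \<le> card (set (cols A))"
        using rank_card_indpt[OF A S] rank by (simp add: card_mono maximal_def)
      then show ?thesis using A
        by (metis card_distinct card_length carrier_matD(2) cols_length le_antisym)
    qed
    then show "\<forall>w\<in>carrier_vec r. A *\<^sub>v w = 0\<^sub>v n \<longrightarrow> w = 0\<^sub>v r"
      using full_rank_lin_indpt[OF A rank] lin_depI[OF A] by blast
  next
    assume inj: "\<forall>w\<in>carrier_vec r. A *\<^sub>v w = 0\<^sub>v n \<longrightarrow> w = 0\<^sub>v r"
    have "distinct (cols A)"
    proof (rule ccontr)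
      assume "\<not> distinct (cols A)"
      \<comment> \<open>Two equal columns i and j would put the difference of the i-th and j-th unit
        vectors into the kernel.\<close>
      then obtain i j where ij: "i < r" "j < r" "i \<noteq> j" "col A i = col A j"
        using A by (auto simp: distinct_conv_nth)
      have "A *\<^sub>v (unit_vec r i - unit_vec r j) = 0\<^sub>v n"
      proof (rule eq_vecI)
        fix a assume "a < dim_vec (0\<^sub>v n :: 'k vec)"
        then have "row A a \<bullet> (unit_vec r i - unit_vec r j) = A $$ (a, i) - A $$ (a, j)"
          using A ij by (subst scalar_prod_minus_distrib[of _ r])
            (auto simp: scalar_prod_right_unit)
        also have "\<dots> = col A i $ a - col A j $ a"
          using A ij(1,2) \<open>a < _\<close> by simp
        finally show "(A *\<^sub>v (unit_vec r i - unit_vec r j)) $ a = 0\<^sub>v n $ a"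
          using A ij \<open>a < _\<close> by simp
      qed (use A in simp)
      with inj have "unit_vec r i - unit_vec r j = (0\<^sub>v r :: 'k vec)" by simp
      from arg_cong[OF this, of "\<lambda>v. v $ i"] ij show False by simp
    qed
    moreover from this have "lin_indpt (set (cols A))"
      using inj by (auto elim: lin_depE[OF A])
    ultimately show "rank A = r" by (rule lin_indpt_full_rank[OF A])
  qed
  with inj_iff A show ?thesis by (simp add: full_rank_def)
qed

section \<open>Inverses by adjugates, square row blocks and normal forms\<close>

text \<open>Writing the inverse through the adjugate makes its entries polynomial in those of
  \<open>A\<close>, apart from the single denominator \<open>det A\<close>.\<close>

lemma adj_mat_inverse:
  assumes A: "A \<in> carrier_mat m m" and det: "det A \<noteq> (0::'k::field)"
  shows "A * (inverse (det A) \<cdot>\<^sub>m adj_mat A) = 1\<^sub>m m"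
    and "(inverse (det A) \<cdot>\<^sub>m adj_mat A) * A = 1\<^sub>m m"
proof -
  have "inverse (det A) \<cdot>\<^sub>m (det A \<cdot>\<^sub>m 1\<^sub>m m) = 1\<^sub>m m"
    using det by (intro eq_matI) auto
  then show "A * (inverse (det A) \<cdot>\<^sub>m adj_mat A) = 1\<^sub>m m"
    "(inverse (det A) \<cdot>\<^sub>m adj_mat A) * A = 1\<^sub>m m"
    using adj_mat[OF A]
      mult_smult_distrib[OF A adj_mat(1)[OF A]] mult_smult_assoc_mat[OF adj_mat(1)[OF A] A]
    by metis+
qed

lemma invertible_mat_iff_det:
  assumes "A \<in> carrier_mat m m"
  shows "invertible_mat A \<longleftrightarrow> det A \<noteq> (0::'k::field)"
proof
  assume "invertible_mat A"
  then obtain B where "inverts_mat A B" "inverts_mat B A"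
    unfolding invertible_mat_def by blast
  then have B: "A * B = 1\<^sub>m m" "B * A = 1\<^sub>m (dim_row B)"
    using assms by (simp_all add: inverts_mat_def)
  have "dim_col B = m" using arg_cong[OF B(1), of dim_col] by simp
  moreover have "dim_row B = m" using arg_cong[OF B(2), of dim_col] assms by simp
  ultimately have "B \<in> carrier_mat m m" by (intro carrier_matI)
  then have "det A * det B = 1" using det_mult[OF assms, of B] B(1) by simp
  then show "det A \<noteq> 0" by auto
next
  define B where "B = inverse (det A) \<cdot>\<^sub>m adj_mat A"
  assume "det A \<noteq> 0"
  then have "A * B = 1\<^sub>m m" "B * A = 1\<^sub>m m"
    unfolding B_def using adj_mat_inverse[OF assms] by simp_all
  moreover have "B \<in> carrier_mat m m" using adj_mat(1)[OF assms] by (simp add: B_def)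
  ultimately have "inverts_mat A B" "inverts_mat B A"
    using assms by (simp_all add: inverts_mat_def)
  then show "invertible_mat A" using assms by (auto simp: invertible_mat_def)
qed

text \<open>Unlike \<open>submatrix\<close>, this has size r by r for every \<open>S\<close> and
  \<open>A\<close>, as \<open>fun_algebra_det\<close> demands of a matrix-valued function at all its
  arguments.\<close>

definition chosen_rows :: "nat set \<Rightarrow> nat \<Rightarrow> 'k mat \<Rightarrow> 'k mat" where
  "chosen_rows S r A = mat r r (\<lambda>(i, j). A $$ (pick S i, j))"

lemma chosen_rows_carrier [simp]: "chosen_rows S r A \<in> carrier_mat r r"
  by (simp add: chosen_rows_def)

lemma chosen_rows_index [simp]:
  "i < r \<Longrightarrow> j < r \<Longrightarrow> chosen_rows S r A $$ (i, j) = A $$ (pick S i, j)"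
  by (simp add: chosen_rows_def)

lemma chosen_rows_dim [simp]: "dim_row (chosen_rows S r A) = r" "dim_col (chosen_rows S r A) = r"
  by (simp_all add: chosen_rows_def)

lemma pick_lt:
  assumes "S \<subseteq> {..<n}" "card S = r" "i < r"
  shows "pick S i < n"
  using assms pick_in_set_le[of i S] by auto

lemma submatrix_eq_chosen_rows:
  assumes "A \<in> carrier_mat n r" "S \<subseteq> {..<n}" "card S = r"
  shows "submatrix A S UNIV = chosen_rows S r A"
proof -
  have "{i. i < n \<and> i \<in> S} = S" using assms by auto
  then show ?thesis using assms by (auto simp: submatrix_def chosen_rows_def pick_UNIV)
qed

lemma chosen_rows_mult:
  assumes "A \<in> carrier_mat n r" "g \<in> carrier_mat r r" "S \<subseteq> {..<n}" "card S = r"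
  shows "chosen_rows S r (A * g) = chosen_rows S r A * g"
proof (rule eq_matI)
  fix i j assume "i < dim_row (chosen_rows S r A * g)" "j < dim_col (chosen_rows S r A * g)"
  then have "i < r" "j < r" using assms by auto
  then show "chosen_rows S r (A * g) $$ (i, j) = (chosen_rows S r A * g) $$ (i, j)"
    using assms pick_lt[OF assms(3,4)] by (simp add: scalar_prod_def)
qed (use assms in auto)

text \<open>A vector killed by \<open>A\<close> is killed by the square block, which is
  injective.\<close>

lemma full_rank_chosen_rows:
  assumes A: "A \<in> carrier_mat n r" and S: "S \<subseteq> {..<n}" "card S = r"
    and det: "det (chosen_rows S r A) \<noteq> (0::'k::field)"
  shows "A \<in> full_rank n r"
  unfolding full_rank_iff
proof (intro conjI A allI impI)
  fix v j assume v: "\<forall>i<n. (\<Sum>j<r. A $$ (i, j) * v j) = 0" and "j < r"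
  have "chosen_rows S r A *\<^sub>v vec r v = 0\<^sub>v r"
    using v pick_lt[OF S] by (auto simp: vec_eq_iff scalar_prod_def atLeast0LessThan)
  then have "vec r v = 0\<^sub>v r"
    using det det_0_iff_vec_prod_zero_field[of "chosen_rows S r A" r] vec_carrier[of r v] chosen_rows_carrier by blast
  then show "v j = 0" using \<open>j < r\<close> by (metis index_vec index_zero_vec(1))
qed

text \<open>The representative of the column space of \<open>B\<close> whose rows in \<open>S\<close> form the identity.\<close>

definition normal_form :: "nat set \<Rightarrow> nat \<Rightarrow> 'k::field mat \<Rightarrow> 'k mat" where
  "normal_form S r B =
     B * (inverse (det (chosen_rows S r B)) \<cdot>\<^sub>m adj_mat (chosen_rows S r B))"

lemma chosen_rows_inverse:
  assumes "det (chosen_rows S r B) \<noteq> (0::'k::field)"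
  shows "chosen_rows S r B * (inverse (det (chosen_rows S r B)) \<cdot>\<^sub>m adj_mat (chosen_rows S r B)) = 1\<^sub>m r"
    and "(inverse (det (chosen_rows S r B)) \<cdot>\<^sub>m adj_mat (chosen_rows S r B)) * chosen_rows S r B = 1\<^sub>m r"
  using adj_mat_inverse[OF chosen_rows_carrier assms] by simp_all

lemma normal_form_carrier:
  assumes "B \<in> carrier_mat n r"
  shows "normal_form S r B \<in> carrier_mat n r"
  using assms adj_mat(1)[of "chosen_rows S r B" r] by (simp add: normal_form_def)

lemma chosen_rows_normal_form:
  assumes "B \<in> carrier_mat n r" "S \<subseteq> {..<n}" "card S = r" "det (chosen_rows S r B) \<noteq> (0::'k::field)"
  shows "chosen_rows S r (normal_form S r B) = 1\<^sub>m r"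
  using assms adj_mat(1)[of "chosen_rows S r B" r]
  by (simp add: normal_form_def chosen_rows_mult[OF assms(1)] chosen_rows_inverse)

lemma normal_form_mult:
  assumes "B \<in> carrier_mat n r" "det (chosen_rows S r B) \<noteq> (0::'k::field)"
  shows "B = normal_form S r B * chosen_rows S r B"
  using assms adj_mat(1)[of "chosen_rows S r B" r]
  by (simp add: normal_form_def assoc_mult_mat[of B n r _ r _ r] chosen_rows_inverse)

section \<open>Polynomial functions of the matrix entries\<close>

lemma fun_algebra_sum:
  assumes "\<And>i. i \<in> I \<Longrightarrow> f i \<in> fun_algebra G"
  shows "(\<lambda>a. \<Sum>i\<in>I. f i a) \<in> fun_algebra G"
  using assms by (induction I rule: infinite_finite_induct) (auto intro: fun_algebra.intros)

lemma fun_algebra_prod: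
  assumes "\<And>i. i \<in> I \<Longrightarrow> f i \<in> fun_algebra G"
  shows "(\<lambda>a. \<Prod>i\<in>I. f i a) \<in> fun_algebra G"
  using assms by (induction I rule: infinite_finite_induct) (auto intro: fun_algebra.intros)

lemma fun_algebra_power:
  "f \<in> fun_algebra G \<Longrightarrow> (\<lambda>a. f a ^ N) \<in> fun_algebra G"
  by (induction N) (auto intro: fun_algebra.intros)

lemma fun_algebra_det:
  assumes "\<And>i j. i < m \<Longrightarrow> j < m \<Longrightarrow> (\<lambda>a. F a $$ (i, j)) \<in> fun_algebra G"
    and "\<And>a. F a \<in> carrier_mat m m"
  shows "(\<lambda>a. det (F a)) \<in> fun_algebra G"
proof -
  have "(\<lambda>a. det (F a)) = (\<lambda>a. \<Sum>p | p permutes {0..<m}.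
    signof p * (\<Prod>i = 0..<m. F a $$ (i, p i)))"
    by (simp add: det_def'[OF assms(2)])
  also have "\<dots> \<in> fun_algebra G"
    by (intro fun_algebra_sum fun_algebra.mult fun_algebra.const fun_algebra_prod assms(1))
      (auto dest: permutes_in_image)
  finally show ?thesis .
qed

lemma mat_poly_entry: "i < n \<Longrightarrow> j < r \<Longrightarrow> (\<lambda>A. A $$ (i, j)) \<in> mat_poly n r"
  unfolding mat_poly_def by (rule fun_algebra.gen) blast

lemma mat_poly_det_rows:
  assumes "S \<subseteq> {..<n}" "card S = r"
  shows "(\<lambda>B::'k::field mat. det (chosen_rows S r B)) \<in> mat_poly n r"
proof -
  have "(\<lambda>B::'k mat. chosen_rows S r B $$ (i, j)) \<in> mat_poly n r" if "i < r" "j < r" for i j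
    using mat_poly_entry[OF pick_lt[OF assms that(1)] that(2)] that by simp
  then show ?thesis
    unfolding mat_poly_def by (rule fun_algebra_det[OF _ chosen_rows_carrier])
qed

text \<open>The adjugate contributes polynomials, so the only denominator is the determinant of the
  chosen block. It is kept apart because q has to be a polynomial function of all matrices,
  including those where the determinant vanishes.\<close>

lemma mat_poly_normal_form:
  assumes S: "S \<subseteq> {..<n}" "card S = r" and "i < n" "j < r"
  shows "\<exists>q\<in>mat_poly n r. \<forall>B::'k::field mat\<in>carrier_mat n r.
    normal_form S r B $$ (i, j) = q B * inverse (det (chosen_rows S r B))"
proof -
  \<comment> \<open>This is the (i, j) entry of \<open>B\<close> times the adjugate of its block;
    the adjugate is transposed, so its (k, j) entry is the cofactor at (j, k).\<close>
  define q where "q B = (\<Sum>k<r. B $$ (i, k) *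
    ((-1) ^ (j + k) * det (mat_delete (chosen_rows S r B) j k)))" for B :: "'k::field mat"
  \<comment> \<open>Deleting row j and column k only shifts the later indices by one, so these are
    still entries of \<open>B\<close>.\<close>
  have entry: "(\<lambda>B::'k mat. mat_delete (chosen_rows S r B) j k $$ (a, b)) \<in> mat_poly n r"
    if ab: "k < r" "a < r - 1" "b < r - 1" for k a b
  proof -
    have "(\<lambda>B::'k mat. mat_delete (chosen_rows S r B) j k $$ (a, b)) =
      (\<lambda>B. B $$ (pick S (if a < j then a else Suc a), if b < k then b else Suc b))"
      using ab by (auto simp: mat_delete_def fun_eq_iff)
    also have "\<dots> \<in> mat_poly n r"
      using ab by (intro mat_poly_entry pick_lt[OF S]) auto
    finally show ?thesis .
  qed
  have "(\<lambda>B::'k mat. det (mat_delete (chosen_rows S r B) j k)) \<in> mat_poly n r" if "k < r" for k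
    using entry[OF that] unfolding mat_poly_def
    by (rule fun_algebra_det) (use mat_delete_dim in \<open>auto intro!: carrier_matI\<close>)
  then have "q \<in> mat_poly n r"
    using mat_poly_entry[OF \<open>i < n\<close>] unfolding q_def[abs_def] mat_poly_def
    by (intro fun_algebra_sum fun_algebra.mult fun_algebra.const) auto
  moreover have "normal_form S r B $$ (i, j) = q B * inverse (det (chosen_rows S r B))"
    if "B \<in> carrier_mat n r" for B
    using assms that
    by (simp add: normal_form_def scalar_prod_def adj_mat_def cofactor_def q_def atLeast0LessThan
        sum_distrib_left ac_simps)
  ultimately show ?thesis by blast
qed

section \<open>Charts of the Grassmannian\<close>

locale grassmannian =
  fixes V :: "('e::ab_group_add \<Rightarrow>\<^sub>0 'k::field) set"
    and x :: "nat \<Rightarrow> 'e \<Rightarrow>\<^sub>0 'k" and n r :: nat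
  assumes basis: "indexed_basis V n x"
begin

sublocale kE: Vector_Spaces.vector_space "kscale ((*) :: ('e \<Rightarrow>\<^sub>0 'k) \<Rightarrow> _)"
  by (rule times_vector_space)

definition lin :: "(nat \<Rightarrow> 'k) \<Rightarrow> 'e \<Rightarrow>\<^sub>0 'k" where
  "lin c = (\<Sum>i<n. kscale (*) (c i) (x i))"

definition minor :: "nat set \<Rightarrow> 'k mat \<Rightarrow> 'k" where
  "minor S A = det (chosen_rows S r A)"

lemma lin_eq_0:
  assumes "lin c = 0" "i < n"
  shows "c i = 0"
  using basis assms kE.independent_family[of "{..<n}" x] by (auto simp: indexed_basis_def lin_def)

lemma lin_inj:
  assumes "lin c = lin d" "i < n"
  shows "c i = d i"
proof -
  have "lin (\<lambda>i. c i - d i) = 0"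
    using assms by (simp add: lin_def kE.scale_left_diff_distrib sum_subtractf)
  from lin_eq_0[OF this assms(2)] show ?thesis by simp
qed

lemma lin_cong: "(\<And>i. i < n \<Longrightarrow> c i = d i) \<Longrightarrow> lin c = lin d"
  by (simp add: lin_def)

lemma V_eq: "V = range lin"
  using basis kE.span_family[of "{..<n}" x] by (simp add: indexed_basis_def lin_def[abs_def])

lemma sum_lin:
  "(\<Sum>j<r. kscale (*) (v j) (lin (\<lambda>i. a i j))) = lin (\<lambda>i. \<Sum>j<r. a i j * v j)"
proof -
  have "(\<Sum>j<r. kscale (*) (v j) (lin (\<lambda>i. a i j))) =
    (\<Sum>j<r. \<Sum>i<n. kscale (*) (a i j * v j) (x i))"
    by (simp add: lin_def kE.scale_sum_right mult.commute)
  also have "\<dots> = lin (\<lambda>i. \<Sum>j<r. a i j * v j)"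
    by (subst sum.swap) (simp add: lin_def kE.scale_sum_left)
  finally show ?thesis .
qed

lemma colspan_span:
  "A \<in> carrier_mat n r \<Longrightarrow> colspan x A = kE.span ((\<lambda>j. lin (\<lambda>i. A $$ (i, j))) ` {..<r})"
  by (simp add: colspan_def lin_def)

lemma colspan_eq:
  assumes "A \<in> carrier_mat n r"
  shows "colspan x A = range (\<lambda>v. lin (\<lambda>i. \<Sum>j<r. A $$ (i, j) * v j))"
  by (simp add: colspan_span[OF assms] kE.span_family sum_lin)

lemma column_in_colspan:
  assumes "A \<in> carrier_mat n r" "j < r"
  shows "lin (\<lambda>i. A $$ (i, j)) \<in> colspan x A"
  using assms by (auto simp: colspan_span intro!: kE.span_base)

lemma columns_independent:
  assumes A: "A \<in> full_rank n r"
  shows "inj_on (\<lambda>j. lin (\<lambda>i. A $$ (i, j))) {..<r}"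
    and "kE.independent ((\<lambda>j. lin (\<lambda>i. A $$ (i, j))) ` {..<r})"
proof -
  have "\<forall>j\<in>{..<r}. v j = 0" if "(\<Sum>j<r. kscale (*) (v j) (lin (\<lambda>i. A $$ (i, j)))) = 0" for v
    using A that lin_eq_0 unfolding sum_lin full_rank_iff by blast
  then show "inj_on (\<lambda>j. lin (\<lambda>i. A $$ (i, j))) {..<r}"
    "kE.independent ((\<lambda>j. lin (\<lambda>i. A $$ (i, j))) ` {..<r})"
    using kE.independent_family[of "{..<r}" "\<lambda>j. lin (\<lambda>i. A $$ (i, j))"] by blast+
qed

text \<open>The coefficients that express the columns of \<open>A'\<close> by those of
  \<open>A\<close> form g; comparing coordinates in the basis \<open>x\<close> turns the relation
  between vectors into one between matrices. Later comparisons of representatives of one subspace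
  rest on this.\<close>

lemma colspan_subset_factor:
  assumes A': "A' \<in> carrier_mat n r" and A: "A \<in> carrier_mat n r"
    and sub: "colspan x A' \<subseteq> colspan x A"
  obtains g where "g \<in> carrier_mat r r" "A' = A * g"
proof -
  have "\<exists>v. \<forall>i<n. A' $$ (i, j) = (\<Sum>k<r. A $$ (i, k) * v k)" if "j < r" for j
    using column_in_colspan[OF A' that] sub lin_inj unfolding colspan_eq[OF A] by blast
  then obtain v where v: "\<And>i j. j < r \<Longrightarrow> i < n \<Longrightarrow> A' $$ (i, j) = (\<Sum>k<r. A $$ (i, k) * v j k)"
    by metis
  show ?thesis
  proof
    show "mat r r (\<lambda>(k, j). v j k) \<in> carrier_mat r r" by simp
    show "A' = A * mat r r (\<lambda>(k, j). v j k)"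
      using A A' v by (intro eq_matI) (auto simp: scalar_prod_def atLeast0LessThan)
  qed
qed

lemma colspan_mult_subset:
  assumes A: "A \<in> carrier_mat n r" and g: "g \<in> carrier_mat r r"
  shows "colspan x (A * g) \<subseteq> colspan x A"
proof -
  have Ag: "A * g \<in> carrier_mat n r" using A g by simp
  have "lin (\<lambda>i. (A * g) $$ (i, j)) \<in> colspan x A" if "j < r" for j
  proof -
    have "lin (\<lambda>i. (A * g) $$ (i, j)) = lin (\<lambda>i. \<Sum>k<r. A $$ (i, k) * g $$ (k, j))"
      using A g that by (intro lin_cong) (simp add: scalar_prod_def atLeast0LessThan)
    then show ?thesis using colspan_eq[OF A] by auto
  qed
  then show ?thesis
    unfolding colspan_span[OF Ag] colspan_span[OF A] by (intro kE.span_minimal) auto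
qed

lemma colspan_in_Grass:
  assumes "A \<in> full_rank n r"
  shows "colspan x A \<in> Grass r V"
proof -
  have A: "A \<in> carrier_mat n r" using assms by (simp add: full_rank_def)
  have "kE.dim (colspan x A) = r"
    using columns_independent[OF assms]
    by (simp add: colspan_span[OF A] kE.dim_eq_card_independent card_image)
  moreover have "colspan x A \<subseteq> V" by (auto simp: V_eq colspan_eq[OF A])
  ultimately show ?thesis by (simp add: Grass_def colspan_span[OF A])
qed

lemma Grass_colspan:
  assumes "U \<in> Grass r V"
  obtains A where "A \<in> full_rank n r" "colspan x A = U"
proof -
  from assms have U: "kE.subspace U" "U \<subseteq> V" "kE.dim U = r" by (auto simp: Grass_def)
  obtain B where B: "B \<subseteq> U" "kE.independent B" "U \<subseteq> kE.span B" "card B = r"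
    using kE.basis_exists[of U] U(3) by blast
  \<comment> \<open>For r = 0 the equation \<open>card B = r\<close> would allow an infinite
    \<open>B\<close>, so finiteness is taken from the finite spanning set of
    \<open>V\<close>.\<close>
  have "finite B"
    using kE.independent_span_bound[of "x ` {..<n}" B] B U basis by (auto simp: indexed_basis_def)
  then obtain b where b: "bij_betw b {..<r} B"
    using ex_bij_betw_nat_finite[of B] B(4) by (auto simp: atLeast0LessThan)
  have "\<exists>c. b j = lin c" if "j < r" for j
    using b B(1) U(2) V_eq bij_betwE[OF b] that by blast
  then obtain a where a: "\<And>j. j < r \<Longrightarrow> b j = lin (a j)" by metis
  define A where "A = mat n r (\<lambda>(i, j). a j i)"
  have A: "A \<in> carrier_mat n r" by (simp add: A_def)
  have bA: "b j = lin (\<lambda>i. A $$ (i, j))" if "j < r" for j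
    unfolding a[OF that] using that by (intro lin_cong) (simp add: A_def)
  have "A \<in> full_rank n r"
    unfolding full_rank_iff
  proof (intro conjI A allI impI)
    fix v j assume v: "\<forall>i<n. (\<Sum>j<r. A $$ (i, j) * v j) = 0" and j: "j < r"
    have "(\<Sum>j<r. kscale (*) (v j) (b j)) = lin (\<lambda>i. \<Sum>j<r. A $$ (i, j) * v j)"
      by (simp add: bA flip: sum_lin)
    also have "\<dots> = 0" using v by (simp add: lin_def)
    finally show "v j = 0"
      using kE.independent_family[of "{..<r}" b] b B(2) j by (auto simp: bij_betw_def)
  qed
  moreover have "colspan x A = U"
  proof -
    have "(\<lambda>j. lin (\<lambda>i. A $$ (i, j))) ` {..<r} = B"
      using b bA by (auto simp: bij_betw_def)
    then show ?thesis using B U(1) colspan_span[OF A] kE.span_minimal[OF B(1) U(1)] by auto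
  qed
  ultimately show ?thesis by (rule that)
qed

definition index_set :: "nat set \<Rightarrow> bool" where
  "index_set S \<longleftrightarrow> S \<subseteq> {..<n} \<and> card S = r"

text \<open>
  The columns of \<open>A\<close> extend to a basis of \<open>V\<close> by vectors \<open>x i\<close>; the indices that are not used
  give the rows of a nonzero minor.
\<close>

lemma ex_nonzero_minor:
  assumes A: "A \<in> full_rank n r"
  obtains S where "index_set S" "minor S A \<noteq> 0"
proof -
  define B0 where "B0 = (\<lambda>j. lin (\<lambda>i. A $$ (i, j))) ` {..<r}"
  have indep: "kE.independent B0" and card_B0: "card B0 = r" and "finite B0"
    using columns_independent[OF A] by (simp_all add: B0_def card_image)
  have X: "inj_on x {..<n}" "kE.independent (x ` {..<n})" "kE.span (x ` {..<n}) = V"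
    using basis by (simp_all add: indexed_basis_def)
  obtain B where B: "B0 \<subseteq> B" "B \<subseteq> B0 \<union> x ` {..<n}" "kE.independent B"
      "B0 \<union> x ` {..<n} \<subseteq> kE.span B"
    using kE.maximal_independent_subset_extend[of B0 "B0 \<union> x ` {..<n}"] indep by blast
  have "B0 \<subseteq> V" by (auto simp: B0_def V_eq)
  have "kE.span B = V"
  proof
    show "kE.span B \<subseteq> V"
      unfolding X(3)[symmetric]
    proof (rule kE.span_minimal[OF _ kE.subspace_span])
      show "B \<subseteq> kE.span (x ` {..<n})"
        using B(2) \<open>B0 \<subseteq> V\<close> X(3) kE.span_superset[of "x ` {..<n}"] by blast
    qed
    show "V \<subseteq> kE.span B"
      unfolding X(3)[symmetric] using B(4) by (intro kE.span_minimal[OF _ kE.subspace_span]) blast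
  qed
  then have "card B = n"
    using kE.dim_span_eq_card_independent[OF B(3)] kE.dim_span_eq_card_independent[OF X(2)] X
    by (simp add: card_image)
  have "finite B" using finite_subset[OF B(2)] \<open>finite B0\<close> by simp
  define T where "T = {i. i < n \<and> x i \<in> B - B0}"
  define S where "S = {..<n} - T"
  have "x ` T = B - B0" using B(2) by (auto simp: T_def)
  moreover have "inj_on x T" by (rule inj_on_subset[OF X(1)]) (auto simp: T_def)
  ultimately have "card T = n - r"
    using \<open>card B = n\<close> card_B0 B(1) \<open>finite B0\<close> by (metis card_Diff_subset card_image)
  moreover have "r \<le> n" using card_mono[OF \<open>finite B\<close> B(1)] \<open>card B = n\<close> card_B0 by simp
  moreover have "T \<subseteq> {..<n}" by (auto simp: T_def)
  ultimately have S: "S \<subseteq> {..<n}" "card S = r"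
    by (auto simp: S_def card_Diff_subset finite_subset)
  have "minor S A \<noteq> 0"
  proof
    assume "minor S A = 0"
    then obtain w where w: "w \<in> carrier_vec r" "w \<noteq> 0\<^sub>v r" "chosen_rows S r A *\<^sub>v w = 0\<^sub>v r"
      using det_0_iff_vec_prod_zero_field[of "chosen_rows S r A" r] by (auto simp: minor_def)
    \<comment> \<open>A kernel vector w of the block gives a combination of the columns of
      \<open>A\<close> without coordinates in \<open>S\<close>. It lies in the span of
      \<open>B0\<close>, and also in that of \<open>B - B0\<close>, which consists of the
      \<open>x i\<close> with i in \<open>T\<close>; independence of \<open>B\<close> forces it to
      be zero.\<close>
    define c where "c i = (\<Sum>j<r. A $$ (i, j) * w $ j)" for i
    have c0: "c i = 0" if "i \<in> S" for i
    proof -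
      \<comment> \<open>The position of i in the increasing enumeration of \<open>S\<close>.\<close>
      define k where "k = card {a \<in> S. a < i}"
      have k: "pick S k = i" unfolding k_def by (rule pick_card_in_set[OF that])
      have "finite S" using S(1) finite_subset by auto
      then have "k < r" unfolding k_def S(2)[symmetric] using that by (intro psubset_card_mono) auto
      have "(chosen_rows S r A *\<^sub>v w) $ k = 0" using w \<open>k < r\<close> by simp
      then show ?thesis
        using \<open>k < r\<close> w(1) k by (simp add: scalar_prod_def atLeast0LessThan c_def)
    qed
    have lin_c: "lin c = (\<Sum>j<r. kscale (*) (w $ j) (lin (\<lambda>i. A $$ (i, j))))"
      by (simp add: c_def[abs_def] sum_lin)
    have u1: "lin c \<in> kE.span B0"
      unfolding lin_c B0_def by (intro kE.span_sum kE.span_scale kE.span_base) auto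
    have "lin c = (\<Sum>i\<in>T. kscale (*) (c i) (x i))"
      unfolding lin_def using c0 by (intro sum.mono_neutral_right) (auto simp: S_def T_def)
    also have "\<dots> \<in> kE.span (B - B0)"
      by (intro kE.span_sum kE.span_scale kE.span_base) (auto simp: T_def)
    finally have u2: "lin c \<in> kE.span (B - B0)" .
    \<comment> \<open>A nonzero coefficient at b would place b both in \<open>B0\<close> and in
      \<open>B - B0\<close>.\<close>
    have "kE.representation B (lin c) b = 0" for b
      using kE.representation_extend[OF B(3) u1 B(1)] kE.representation_extend[OF B(3) u2]
        kE.representation_ne_zero by (metis DiffD2 Diff_subset)
    moreover have "lin c \<in> kE.span B" using u1 B(1) kE.span_mono by blast
    ultimately have "lin c = 0" using kE.sum_nonzero_representation_eq[OF B(3)] by fastforce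
    then have "\<forall>j<r. w $ j = 0"
      using lin_eq_0 A unfolding c_def[abs_def] full_rank_iff by blast
    with w show False by (auto simp: vec_eq_iff)
  qed
  with S show ?thesis using that by (auto simp: index_set_def)
qed

section \<open>Normalised representatives and membership in charts\<close>

definition rep :: "nat set \<Rightarrow> ('e \<Rightarrow>\<^sub>0 'k) set \<Rightarrow> 'k mat" where
  "rep S U = (THE A. A \<in> full_rank n r \<and> colspan x A = U \<and> submatrix A S UNIV = 1\<^sub>m r)"

lemma Ycoord_eq: "Ycoord x n r S i j U = rep S U $$ (i, j)"
  by (simp add: Ycoord_def rep_def)

lemma full_rank_carrier: "A \<in> full_rank n r \<Longrightarrow> A \<in> carrier_mat n r"
  by (simp add: full_rank_def)

lemma normal_form_full_rank:
  assumes B: "B \<in> carrier_mat n r" and S: "index_set S" and nz: "minor S B \<noteq> 0"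
  shows "normal_form S r B \<in> full_rank n r" "colspan x (normal_form S r B) = colspan x B"
    "submatrix (normal_form S r B) S UNIV = 1\<^sub>m r"
proof -
  note S' = S[unfolded index_set_def, THEN conjunct1] S[unfolded index_set_def, THEN conjunct2]
  note nz' = nz[unfolded minor_def]
  have N: "normal_form S r B \<in> carrier_mat n r" by (rule normal_form_carrier[OF B])
  show "submatrix (normal_form S r B) S UNIV = 1\<^sub>m r"
    by (simp add: submatrix_eq_chosen_rows[OF N S'] chosen_rows_normal_form[OF B S' nz'])
  show "normal_form S r B \<in> full_rank n r"
    by (rule full_rank_chosen_rows[OF N S']) (simp add: chosen_rows_normal_form[OF B S' nz'])
  show "colspan x (normal_form S r B) = colspan x B"
  proof
    show "colspan x (normal_form S r B) \<subseteq> colspan x B"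
      unfolding normal_form_def using adj_mat(1)[of "chosen_rows S r B" r]
      by (intro colspan_mult_subset[OF B]) auto
    show "colspan x B \<subseteq> colspan x (normal_form S r B)"
      using colspan_mult_subset[OF N, of "chosen_rows S r B"] normal_form_mult[OF B nz'] by simp
  qed
qed

text \<open>Any other normalised representative is \<open>normal_form S r B * g\<close>, and its
  rows in \<open>S\<close> form g itself, so g is the identity. The definite description thus gets
  an explicit value, from which the regularity of the coordinates is read off.\<close>

lemma rep_colspan:
  assumes B: "B \<in> carrier_mat n r" and S: "index_set S" and nz: "minor S B \<noteq> 0"
  shows "rep S (colspan x B) = normal_form S r B"
  unfolding rep_def
proof (rule the_equality)
  note nf = normal_form_full_rank[OF assms]
  show "normal_form S r B \<in> full_rank n r \<and> colspan x (normal_form S r B) = colspan x B \<and>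
    submatrix (normal_form S r B) S UNIV = 1\<^sub>m r"
    using nf by simp
  fix A assume A: "A \<in> full_rank n r \<and> colspan x A = colspan x B \<and> submatrix A S UNIV = 1\<^sub>m r"
  have A': "A \<in> carrier_mat n r" using A by (simp add: full_rank_carrier)
  have S': "S \<subseteq> {..<n}" "card S = r" using S by (simp_all add: index_set_def)
  have N: "normal_form S r B \<in> carrier_mat n r" by (rule normal_form_carrier[OF B])
  obtain g where g: "g \<in> carrier_mat r r" "A = normal_form S r B * g"
    using colspan_subset_factor[OF A' N] A nf by auto
  have "1\<^sub>m r = chosen_rows S r A" using A submatrix_eq_chosen_rows[OF A' S'] by simp
  also have "\<dots> = g"
    using g chosen_rows_mult[OF N g(1) S'] chosen_rows_normal_form[OF B S'] nz
    by (simp add: minor_def)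
  finally show "A = normal_form S r B" using g(2) right_mult_one_mat[OF N] by simp
qed

text \<open>Passing to another representative multiplies the minor by a determinant, so the
  existential in \<open>chart\<close> can be tested on any one representative.\<close>

lemma colspan_in_chart_iff:
  assumes B: "B \<in> full_rank n r" and S: "index_set S"
  shows "colspan x B \<in> chart V x n r S \<longleftrightarrow> minor S B \<noteq> 0"
proof -
  have S': "S \<subseteq> {..<n}" "card S = r" using S by (simp_all add: index_set_def)
  have inv: "invertible_mat (submatrix A S UNIV) \<longleftrightarrow> minor S A \<noteq> 0" if "A \<in> full_rank n r" for A
    using that by (simp add: submatrix_eq_chosen_rows[OF full_rank_carrier S'] minor_def
        invertible_mat_iff_det[OF chosen_rows_carrier])
  show ?thesis
  proof
    assume "colspan x B \<in> chart V x n r S"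
    then obtain A where A: "A \<in> full_rank n r" "colspan x A = colspan x B" "minor S A \<noteq> 0"
      using inv by (auto simp: chart_def)
    obtain g where g: "g \<in> carrier_mat r r" "A = B * g"
      using colspan_subset_factor[OF full_rank_carrier[OF A(1)] full_rank_carrier[OF B]] A(2) by auto
    have "minor S A = minor S B * det g"
      unfolding minor_def g(2) chosen_rows_mult[OF full_rank_carrier[OF B] g(1) S']
      by (rule det_mult[OF chosen_rows_carrier g(1)])
    with A show "minor S B \<noteq> 0" by auto
  next
    assume "minor S B \<noteq> 0"
    then show "colspan x B \<in> chart V x n r S"
      using B inv[OF B] colspan_in_Grass[OF B] by (auto simp: chart_def)
  qed
qed

lemma rep_chart:
  assumes S: "index_set S" and U: "U \<in> chart V x n r S"
  shows "rep S U \<in> full_rank n r" "colspan x (rep S U) = U" "chosen_rows S r (rep S U) = 1\<^sub>m r"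
proof -
  have S': "S \<subseteq> {..<n}" "card S = r" using S by (simp_all add: index_set_def)
  obtain A where A: "A \<in> full_rank n r" "colspan x A = U" using U by (auto simp: chart_def)
  then have nz: "minor S A \<noteq> 0" using U colspan_in_chart_iff[OF A(1) S] by simp
  note nf = normal_form_full_rank[OF full_rank_carrier[OF A(1)] S nz]
    rep_colspan[OF full_rank_carrier[OF A(1)] S nz]
  show "rep S U \<in> full_rank n r" "colspan x (rep S U) = U" using nf A(2) by simp_all
  show "chosen_rows S r (rep S U) = 1\<^sub>m r"
    using nf A(2) submatrix_eq_chosen_rows[OF full_rank_carrier[OF nf(1)] S'] by simp
qed

lemma rep_pick:
  assumes "index_set S" "U \<in> chart V x n r S" "k < r" "j < r"
  shows "rep S U $$ (pick S k, j) = (if k = j then 1 else 0)"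
  using arg_cong[OF rep_chart(3)[OF assms(1,2)], of "\<lambda>A. A $$ (k, j)"] assms(3,4) by simp

lemma chart_subset: "chart V x n r S \<subseteq> Grass r V"
  by (auto simp: chart_def)

lemma ex_chart:
  assumes "U \<in> Grass r V"
  obtains S where "index_set S" "U \<in> chart V x n r S"
  using assms Grass_colspan ex_nonzero_minor colspan_in_chart_iff by metis

section \<open>Open sets of the Grassmannian\<close>

abbreviation "gopen \<equiv> gr_open V x n r"
abbreviation "ch \<equiv> chart V x n r"
abbreviation "matpoly \<equiv> mat_poly n r :: ('k mat \<Rightarrow> 'k) set"
abbreviation "cr \<equiv> chart_ring V x n r"

lemma gr_openI:
  assumes "W \<subseteq> Grass r V" "P \<subseteq> matpoly"
    and "\<And>B. B \<in> full_rank n r \<Longrightarrow> colspan x B \<in> W \<longleftrightarrow> (\<exists>f\<in>P. f B \<noteq> 0)"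
  shows "gopen W"
proof -
  have "gr_preimage x n r W = {A \<in> full_rank n r. \<exists>f\<in>P. f A \<noteq> 0}"
    using assms(3) by (auto simp: gr_preimage_def)
  with assms(1,2) show ?thesis unfolding gr_open_def mat_open_def by blast
qed

lemma gr_openE:
  assumes "gopen W"
  obtains P where "P \<subseteq> matpoly"
    and "\<And>B. B \<in> full_rank n r \<Longrightarrow> colspan x B \<in> W \<longleftrightarrow> (\<exists>f\<in>P. f B \<noteq> 0)"
proof -
  obtain P where P: "P \<subseteq> matpoly"
      "gr_preimage x n r W = {A \<in> full_rank n r. \<exists>f\<in>P. f A \<noteq> 0}"
    using assms by (auto simp: gr_open_def mat_open_def)
  have "colspan x B \<in> W \<longleftrightarrow> (\<exists>f\<in>P. f B \<noteq> 0)" if "B \<in> full_rank n r" for B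
    using that P(2) by (auto simp: gr_preimage_def)
  with P(1) show ?thesis by (rule that)
qed

lemma gr_open_Grass: "gopen W \<Longrightarrow> W \<subseteq> Grass r V"
  by (simp add: gr_open_def)

lemma gr_open_Int:
  assumes "gopen W" "gopen W'"
  shows "gopen (W \<inter> W')"
proof -
  obtain P where P: "P \<subseteq> matpoly"
      "\<And>B. B \<in> full_rank n r \<Longrightarrow> colspan x B \<in> W \<longleftrightarrow> (\<exists>f\<in>P. f B \<noteq> 0)"
    by (rule gr_openE[OF assms(1)]) blast
  obtain Q where Q: "Q \<subseteq> matpoly"
      "\<And>B. B \<in> full_rank n r \<Longrightarrow> colspan x B \<in> W' \<longleftrightarrow> (\<exists>f\<in>Q. f B \<noteq> 0)"
    by (rule gr_openE[OF assms(2)]) blast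
  show ?thesis
  proof (rule gr_openI)
    show "W \<inter> W' \<subseteq> Grass r V" using gr_open_Grass[OF assms(1)] by blast
    show "(\<lambda>(f, g) A. f A * g A) ` (P \<times> Q) \<subseteq> matpoly"
      using P(1) Q(1) by (auto simp: mat_poly_def intro!: fun_algebra.mult)
    fix B :: "'k mat" assume "B \<in> full_rank n r"
    then show "colspan x B \<in> W \<inter> W' \<longleftrightarrow> (\<exists>f\<in>(\<lambda>(f, g) A. f A * g A) ` (P \<times> Q). f B \<noteq> 0)"
      using P(2) Q(2) by fastforce
  qed
qed

lemma gr_open_Union:
  assumes "\<And>W. W \<in> C \<Longrightarrow> gopen W"
  shows "gopen (\<Union>C)"
proof -
  have "\<forall>W\<in>C. \<exists>P. P \<subseteq> matpoly \<and>
    (\<forall>B\<in>full_rank n r. colspan x B \<in> W \<longleftrightarrow> (\<exists>f\<in>P. f B \<noteq> 0))"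
    using assms gr_openE by metis
  then obtain P where P: "\<And>W. W \<in> C \<Longrightarrow> P W \<subseteq> matpoly"
      "\<And>W B. W \<in> C \<Longrightarrow> B \<in> full_rank n r \<Longrightarrow> colspan x B \<in> W \<longleftrightarrow> (\<exists>f\<in>P W. f B \<noteq> 0)"
    by metis
  show ?thesis
  proof (rule gr_openI)
    show "\<Union>C \<subseteq> Grass r V" using assms gr_open_Grass by blast
    show "\<Union>(P ` C) \<subseteq> matpoly" using P(1) by blast
    fix B :: "'k mat" assume "B \<in> full_rank n r"
    then show "colspan x B \<in> \<Union>C \<longleftrightarrow> (\<exists>f\<in>\<Union>(P ` C). f B \<noteq> 0)"
      using P(2) by auto
  qed
qed

section \<open>The coordinate ring of a chart and its principal open sets\<close>

lemma chart_ring_iff: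
  "f \<in> cr S \<longleftrightarrow> (\<exists>g\<in>fun_algebra {Ycoord x n r S i j | i j. i < n \<and> i \<notin> S \<and> j < r}.
     f = restrict g (ch S))"
  by (auto simp: chart_ring_def)

lemma chart_ring_const: "(\<lambda>U\<in>ch S. c) \<in> cr S"
  unfolding chart_ring_iff by (intro bexI[OF _ fun_algebra.const]) simp

lemma chart_ring_add:
  assumes "f \<in> cr S" "g \<in> cr S"
  shows "(\<lambda>U\<in>ch S. f U + g U) \<in> cr S"
proof -
  let ?A = "fun_algebra {Ycoord x n r S i j | i j. i < n \<and> i \<notin> S \<and> j < r}"
  obtain f' g' where "f' \<in> ?A" "f = restrict f' (ch S)" "g' \<in> ?A" "g = restrict g' (ch S)"
    using assms by (auto simp: chart_ring_iff)
  then show ?thesis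
    unfolding chart_ring_iff
    by (intro bexI[of _ "\<lambda>U. f' U + g' U"] fun_algebra.add) (auto simp: fun_eq_iff)
qed

lemma chart_ring_mult:
  assumes "f \<in> cr S" "g \<in> cr S"
  shows "(\<lambda>U\<in>ch S. f U * g U) \<in> cr S"
proof -
  let ?A = "fun_algebra {Ycoord x n r S i j | i j. i < n \<and> i \<notin> S \<and> j < r}"
  obtain f' g' where "f' \<in> ?A" "f = restrict f' (ch S)" "g' \<in> ?A" "g = restrict g' (ch S)"
    using assms by (auto simp: chart_ring_iff)
  then show ?thesis
    unfolding chart_ring_iff
    by (intro bexI[of _ "\<lambda>U. f' U * g' U"] fun_algebra.mult) (auto simp: fun_eq_iff)
qed

lemma chart_ring_sum:
  assumes "\<And>i. i \<in> I \<Longrightarrow> f i \<in> cr S"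
  shows "(\<lambda>U\<in>ch S. \<Sum>i\<in>I. f i U) \<in> cr S"
  using assms
proof (induction I rule: infinite_finite_induct)
  case (insert i I)
  then have "(\<lambda>U\<in>ch S. f i U + (\<lambda>U\<in>ch S. \<Sum>i\<in>I. f i U) U) \<in> cr S"
    by (intro chart_ring_add) auto
  also have "(\<lambda>U\<in>ch S. f i U + (\<lambda>U\<in>ch S. \<Sum>i\<in>I. f i U) U) = (\<lambda>U\<in>ch S. \<Sum>i\<in>insert i I. f i U)"
    using insert by (auto simp: fun_eq_iff)
  finally show ?case .
qed (simp_all add: chart_ring_const)

text \<open>On the chart, \<open>rep S\<close> is a section of the map from matrices to subspaces;
  its entries are the coordinates outside \<open>S\<close> and the constants 0 and 1 inside. This
  carries functions of matrices back to the chart.\<close>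

lemma chart_ring_poly:
  assumes S: "index_set S" and q: "q \<in> matpoly"
  shows "(\<lambda>U\<in>ch S. q (rep S U)) \<in> cr S"
  using q unfolding mat_poly_def
proof (induction rule: fun_algebra.induct)
  case (gen g)
  then obtain i j where g: "g = (\<lambda>A. A $$ (i, j))" and ij: "i < n" "j < r" by blast
  show ?case
  proof (cases "i \<in> S")
    case False
    then have "Ycoord x n r S i j \<in> fun_algebra {Ycoord x n r S i j | i j. i < n \<and> i \<notin> S \<and> j < r}"
      using ij by (intro fun_algebra.gen) blast
    then show ?thesis
      unfolding chart_ring_iff by (rule bexI[rotated]) (simp add: g fun_eq_iff Ycoord_eq)
  next
    case True
    \<comment> \<open>Row i is the k-th chosen row, so its entries are those of the identity
      matrix.\<close>
    define k where "k = card {a \<in> S. a < i}"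
    have k: "pick S k = i" unfolding k_def by (rule pick_card_in_set[OF True])
    have "finite S" "card S = r" using S by (auto simp: index_set_def finite_subset)
    then have "k < r" unfolding k_def using True by (auto intro!: psubset_card_mono)
    then have "(\<lambda>U\<in>ch S. g (rep S U)) = (\<lambda>U\<in>ch S. if k = j then 1 else 0)"
      using rep_pick[OF S _ _ ij(2)] k by (auto simp: g fun_eq_iff)
    then show ?thesis by (simp only: chart_ring_const)
  qed
next
  case (const c)
  show ?case by (rule chart_ring_const)
next
  case (add f g)
  from chart_ring_add[OF add.IH] show ?case by (simp add: restrict_def cong: if_cong)
next
  case (mult f g)
  from chart_ring_mult[OF mult.IH] show ?case by (simp add: restrict_def cong: if_cong)
qed

lemma minor_poly: "index_set S \<Longrightarrow> minor S \<in> matpoly"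
  unfolding minor_def[abs_def] index_set_def by (intro mat_poly_det_rows) auto

lemma mat_poly_minor_power_mult:
  assumes "index_set S" "q \<in> matpoly"
  shows "(\<lambda>B. q B * minor S B ^ N) \<in> matpoly"
  using assms(2) minor_poly[OF assms(1)] unfolding mat_poly_def
  by (intro fun_algebra.mult fun_algebra_power)

text \<open>Cramer's rule: the denominators of the coordinates are powers of the minor.\<close>

lemma chart_ring_colspan:
  assumes S: "index_set S" and g: "g \<in> cr S"
  obtains q N where "q \<in> matpoly"
    "\<And>B. B \<in> full_rank n r \<Longrightarrow> minor S B \<noteq> 0 \<Longrightarrow> g (colspan x B) = q B * inverse (minor S B ^ N)"
proof -
  obtain f where f: "f \<in> fun_algebra {Ycoord x n r S i j | i j. i < n \<and> i \<notin> S \<and> j < r}"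
      and g: "g = restrict f (ch S)"
    using g by (auto simp: chart_ring_iff)
  have "\<exists>q\<in>matpoly. \<exists>N. \<forall>B\<in>full_rank n r. minor S B \<noteq> 0 \<longrightarrow>
    f (colspan x B) = q B * inverse (minor S B ^ N)"
    using f
  proof (induction rule: fun_algebra.induct)
    case (gen g)
    then obtain i j where g: "g = Ycoord x n r S i j" and ij: "i < n" "j < r" by blast
    obtain q where "q \<in> matpoly"
        "\<And>B. B \<in> carrier_mat n r \<Longrightarrow> normal_form S r B $$ (i, j) = q B * inverse (minor S B)"
      using mat_poly_normal_form[of S n r i j] S ij unfolding index_set_def minor_def by blast
    then show ?case
      by (intro bexI[of _ q] exI[of _ 1])
        (auto simp: g Ycoord_eq rep_colspan[OF full_rank_carrier S] full_rank_carrier)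
  next
    case (const c)
    have "(\<lambda>_. c) \<in> matpoly" unfolding mat_poly_def by (rule fun_algebra.const)
    then show ?case by (intro bexI[of _ "\<lambda>_. c"] exI[of _ 0]) auto
  next
    case (add f g)
    from add.IH(1) obtain q N where q: "q \<in> matpoly" "\<forall>B\<in>full_rank n r. minor S B \<noteq> 0 \<longrightarrow>
      f (colspan x B) = q B * inverse (minor S B ^ N)" by blast
    from add.IH(2) obtain q' N' where q': "q' \<in> matpoly" "\<forall>B\<in>full_rank n r. minor S B \<noteq> 0 \<longrightarrow>
      g (colspan x B) = q' B * inverse (minor S B ^ N')" by blast
    have "(\<lambda>B. q B * minor S B ^ N' + q' B * minor S B ^ N) \<in> matpoly"
      using mat_poly_minor_power_mult[OF S] q(1) q'(1) unfolding mat_poly_def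
      by (intro fun_algebra.add) auto
    moreover have "f (colspan x B) + g (colspan x B) =
        (q B * minor S B ^ N' + q' B * minor S B ^ N) * inverse (minor S B ^ (N + N'))"
      if "B \<in> full_rank n r" "minor S B \<noteq> 0" for B
      using that q(2) q'(2) by (simp add: power_add field_simps)
    ultimately show ?case
      by (intro bexI[of _ "\<lambda>B. q B * minor S B ^ N' + q' B * minor S B ^ N"] exI[of _ "N + N'"]) simp_all
  next
    case (mult f g)
    from mult.IH(1) obtain q N where q: "q \<in> matpoly" "\<forall>B\<in>full_rank n r. minor S B \<noteq> 0 \<longrightarrow>
      f (colspan x B) = q B * inverse (minor S B ^ N)" by blast
    from mult.IH(2) obtain q' N' where q': "q' \<in> matpoly" "\<forall>B\<in>full_rank n r. minor S B \<noteq> 0 \<longrightarrow>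
      g (colspan x B) = q' B * inverse (minor S B ^ N')" by blast
    have "(\<lambda>B. q B * q' B) \<in> matpoly"
      using q(1) q'(1) unfolding mat_poly_def by (rule fun_algebra.mult)
    moreover have "f (colspan x B) * g (colspan x B) = q B * q' B * inverse (minor S B ^ (N + N'))"
      if "B \<in> full_rank n r" "minor S B \<noteq> 0" for B
      using that q(2) q'(2) by (simp add: power_add)
    ultimately show ?case
      by (intro bexI[of _ "\<lambda>B. q B * q' B"] exI[of _ "N + N'"]) simp_all
  qed
  then obtain q N where "q \<in> matpoly"
    "\<forall>B\<in>full_rank n r. minor S B \<noteq> 0 \<longrightarrow> f (colspan x B) = q B * inverse (minor S B ^ N)"
    by blast
  then show ?thesis
    using colspan_in_chart_iff[OF _ S] by (intro that[of q N]) (auto simp: g)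
qed

definition basic_open :: "nat set \<Rightarrow> (('e \<Rightarrow>\<^sub>0 'k) set \<Rightarrow> 'k) \<Rightarrow> ('e \<Rightarrow>\<^sub>0 'k) set set" where
  "basic_open S h = {U \<in> ch S. h U \<noteq> 0}"

lemma gr_open_basic_open:
  assumes S: "index_set S" and h: "h \<in> cr S"
  shows "gopen (basic_open S h)"
proof -
  obtain q N where q: "q \<in> matpoly"
    "\<And>B. B \<in> full_rank n r \<Longrightarrow> minor S B \<noteq> 0 \<Longrightarrow> h (colspan x B) = q B * inverse (minor S B ^ N)"
    by (rule chart_ring_colspan[OF assms]) blast
  show ?thesis
  proof (rule gr_openI)
    show "basic_open S h \<subseteq> Grass r V" using chart_subset by (auto simp: basic_open_def)
    \<comment> \<open>The formula for h is available only where the minor is nonzero; the extra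
      factor restricts the locus to the chart.\<close>
    show "{\<lambda>B. minor S B * q B} \<subseteq> matpoly"
      using minor_poly[OF S] q(1) by (auto simp: mat_poly_def intro!: fun_algebra.mult)
    fix B :: "'k mat" assume "B \<in> full_rank n r"
    then show "colspan x B \<in> basic_open S h \<longleftrightarrow> (\<exists>f\<in>{\<lambda>B. minor S B * q B}. f B \<noteq> 0)"
      using q(2)[of B] colspan_in_chart_iff[OF _ S, of B] by (auto simp: basic_open_def)
  qed
qed

lemma gr_open_chart:
  assumes "index_set S"
  shows "gopen (ch S)"
  using gr_open_basic_open[OF assms chart_ring_const[of 1 S]]
  by (simp add: basic_open_def cong: conj_cong)

lemma basic_open_mult:
  "basic_open S (\<lambda>U\<in>ch S. f U * g U) = basic_open S f \<inter> basic_open S g"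
  by (auto simp: basic_open_def)

text \<open>One of the polynomials defining \<open>W\<close> is nonzero at \<open>rep S U\<close>;
  pulled back along \<open>rep S\<close> it is the required h. Hence principal open sets form a base
  of the topology of the chart.\<close>

lemma basic_open_base:
  assumes S: "index_set S" and W: "gopen W" and U: "U \<in> W" "U \<in> ch S"
  obtains h where "h \<in> cr S" "U \<in> basic_open S h" "basic_open S h \<subseteq> W"
proof -
  obtain P where P: "P \<subseteq> matpoly"
    "\<And>B. B \<in> full_rank n r \<Longrightarrow> colspan x B \<in> W \<longleftrightarrow> (\<exists>f\<in>P. f B \<noteq> 0)"
    by (rule gr_openE[OF W]) blast
  obtain f where f: "f \<in> P" "f (rep S U) \<noteq> 0"
    using P(2)[OF rep_chart(1)[OF S U(2)]] rep_chart(2)[OF S U(2)] U(1) by auto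
  show ?thesis
  proof
    show "(\<lambda>U\<in>ch S. f (rep S U)) \<in> cr S" using f(1) P(1) by (intro chart_ring_poly[OF S]) auto
    show "U \<in> basic_open S (\<lambda>U\<in>ch S. f (rep S U))" using U f(2) by (simp add: basic_open_def)
    show "basic_open S (\<lambda>U\<in>ch S. f (rep S U)) \<subseteq> W"
    proof
      fix U' assume "U' \<in> basic_open S (\<lambda>U\<in>ch S. f (rep S U))"
      then have U': "U' \<in> ch S" "f (rep S U') \<noteq> 0" by (auto simp: basic_open_def split: if_splits)
      then show "U' \<in> W"
        using P(2)[OF rep_chart(1)[OF S U'(1)]] rep_chart(2)[OF S U'(1)] f(1) by auto
    qed
  qed
qed

subsection \<open>Regular functions as fractions in a chart\<close>

text \<open>Regularity of a germ, expressed in the coordinate ring of a single chart. The fraction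
  has to represent f on the whole locus where its denominator is nonzero, so a smaller neighbourhood
  is recorded by a new denominator instead of a separate open set.\<close>

definition regular_at :: "nat set \<Rightarrow> (('e \<Rightarrow>\<^sub>0 'k) set \<Rightarrow> 'k) \<Rightarrow> ('e \<Rightarrow>\<^sub>0 'k) set \<Rightarrow> bool" where
  "regular_at S f U \<longleftrightarrow> (\<exists>a\<in>cr S. \<exists>h\<in>cr S. U \<in> basic_open S h \<and>
     (\<forall>U'\<in>basic_open S h. f U' = inverse (h U') * a U'))"

text \<open>Expanding the fraction by g leaves its values unchanged and cuts its domain down to
  where g is nonzero as well.\<close>

lemma regular_at_shrink:
  assumes S: "index_set S" and f: "regular_at S f U" and W: "gopen W" "U \<in> W"
  obtains a h where "a \<in> cr S" "h \<in> cr S" "U \<in> basic_open S h" "basic_open S h \<subseteq> W"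
    "\<And>U'. U' \<in> basic_open S h \<Longrightarrow> f U' = inverse (h U') * a U'"
proof -
  obtain a h where ah: "a \<in> cr S" "h \<in> cr S" "U \<in> basic_open S h"
    "\<And>U'. U' \<in> basic_open S h \<Longrightarrow> f U' = inverse (h U') * a U'"
    using f unfolding regular_at_def by blast
  obtain g where g: "g \<in> cr S" "U \<in> basic_open S g" "basic_open S g \<subseteq> W"
    using basic_open_base[OF S W] ah(3) by (auto simp: basic_open_def)
  show ?thesis
  proof (rule that[OF chart_ring_mult[OF ah(1) g(1)] chart_ring_mult[OF ah(2) g(1)]])
    show "U \<in> basic_open S (\<lambda>U\<in>ch S. h U * g U)" "basic_open S (\<lambda>U\<in>ch S. h U * g U) \<subseteq> W"
      using ah(3) g by (auto simp: basic_open_mult)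
    fix U' assume "U' \<in> basic_open S (\<lambda>U\<in>ch S. h U * g U)"
    then have "U' \<in> basic_open S h" "U' \<in> ch S" "h U' \<noteq> 0" "g U' \<noteq> 0"
      by (auto simp: basic_open_mult basic_open_def)
    then show "f U' = inverse ((\<lambda>U\<in>ch S. h U * g U) U') * (\<lambda>U\<in>ch S. a U * g U) U'"
      using ah(4) by (simp add: field_simps)
  qed
qed

lemma regular_at_cong:
  assumes "index_set S" "regular_at S f U" "gopen W" "U \<in> W" "\<And>U'. U' \<in> W \<Longrightarrow> f U' = g U'"
  shows "regular_at S g U"
proof -
  obtain a h where "a \<in> cr S" "h \<in> cr S" "U \<in> basic_open S h" "basic_open S h \<subseteq> W"
    "\<And>U'. U' \<in> basic_open S h \<Longrightarrow> f U' = inverse (h U') * a U'"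
    by (rule regular_at_shrink[OF assms(1-4)]) blast
  then show ?thesis unfolding regular_at_def using assms(5) by (metis subsetD)
qed

lemma OGr_regular_at:
  assumes S: "index_set S" and f: "f \<in> OGr x n r W" and U: "U \<in> W" "U \<in> ch S"
  shows "regular_at S f U"
proof -
  have "rep S U \<in> gr_preimage x n r W"
    using rep_chart(1,2)[OF S U(2)] U(1) by (simp add: gr_preimage_def)
  then obtain Z a b where Z: "a \<in> matpoly" "b \<in> matpoly" "mat_open n r Z" "rep S U \<in> Z"
    "\<And>B. B \<in> Z \<Longrightarrow> b B \<noteq> 0 \<and> f (colspan x B) = a B / b B"
    using f unfolding OGr_def by blast
  obtain P where P: "P \<subseteq> matpoly" "Z = {A \<in> full_rank n r. \<exists>f\<in>P. f A \<noteq> 0}"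
    using Z(3) by (auto simp: mat_open_def)
  then obtain q where q: "q \<in> P" "q (rep S U) \<noteq> 0" using Z(4) by auto
  \<comment> \<open>The polynomial q is nonzero at \<open>rep S U\<close> and its nonvanishing locus
    lies in \<open>Z\<close>. Expanding by q therefore lets the denominator alone guarantee that the
    representative stays in \<open>Z\<close>.\<close>
  have poly: "(\<lambda>A. a A * q A) \<in> matpoly" "(\<lambda>A. b A * q A) \<in> matpoly"
    using Z(1,2) q(1) P(1) unfolding mat_poly_def by (auto intro!: fun_algebra.mult)
  define a' h where "a' = (\<lambda>U\<in>ch S. a (rep S U) * q (rep S U))"
    and "h = (\<lambda>U\<in>ch S. b (rep S U) * q (rep S U))"
  have "a' \<in> cr S" "h \<in> cr S"
    unfolding a'_def h_def using chart_ring_poly[OF S poly(1)] chart_ring_poly[OF S poly(2)] by simp_all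
  moreover have "U \<in> basic_open S h" using U(2) q(2) Z(4,5) by (simp add: basic_open_def h_def)
  moreover have "f U' = inverse (h U') * a' U'" if "U' \<in> basic_open S h" for U'
  proof -
    from that have U': "U' \<in> ch S" "b (rep S U') \<noteq> 0" "q (rep S U') \<noteq> 0"
      by (auto simp: basic_open_def h_def)
    then have "rep S U' \<in> Z" using P(2) q(1) rep_chart(1)[OF S U'(1)] by auto
    then have "f U' = a (rep S U') / b (rep S U')"
      using Z(5)[of "rep S U'"] rep_chart(2)[OF S U'(1)] by simp
    then show ?thesis using U' by (simp add: a'_def h_def field_simps)
  qed
  ultimately show ?thesis unfolding regular_at_def by blast
qed

lemma regular_at_OGr:
  assumes W: "gopen W" and f: "f \<in> extensional W"
    and reg: "\<And>U. U \<in> W \<Longrightarrow> \<exists>S. index_set S \<and> regular_at S f U"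
  shows "f \<in> OGr x n r W"
  unfolding OGr_def
proof (intro CollectI conjI f ballI)
  fix A assume "A \<in> gr_preimage x n r W"
  then have A: "A \<in> full_rank n r" "colspan x A \<in> W" by (auto simp: gr_preimage_def)
  obtain S where S: "index_set S" "regular_at S f (colspan x A)" using reg[OF A(2)] by blast
  obtain a h where ah: "a \<in> cr S" "h \<in> cr S" "colspan x A \<in> basic_open S h" "basic_open S h \<subseteq> W"
    "\<And>U'. U' \<in> basic_open S h \<Longrightarrow> f U' = inverse (h U') * a U'"
    by (rule regular_at_shrink[OF S W A(2)]) blast
  obtain p M where p: "p \<in> matpoly"
    "\<And>B. B \<in> full_rank n r \<Longrightarrow> minor S B \<noteq> 0 \<Longrightarrow> a (colspan x B) = p B * inverse (minor S B ^ M)"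
    by (rule chart_ring_colspan[OF S(1) ah(1)]) blast
  obtain q N where q: "q \<in> matpoly"
    "\<And>B. B \<in> full_rank n r \<Longrightarrow> minor S B \<noteq> 0 \<Longrightarrow> h (colspan x B) = q B * inverse (minor S B ^ N)"
    by (rule chart_ring_colspan[OF S(1) ah(2)]) blast
  let ?Z = "gr_preimage x n r (basic_open S h)"
  have "mat_open n r ?Z"
    using gr_open_basic_open[OF S(1) ah(2)] by (simp add: gr_open_def)
  moreover have "A \<in> ?Z" using A ah(3) by (simp add: gr_preimage_def)
  moreover have "?Z \<subseteq> gr_preimage x n r W"
    using ah(4) by (auto simp: gr_preimage_def)
  \<comment> \<open>On the chart a is p over the M-th power of the minor and h is q over its N-th
    power; clearing these powers in a/h crosses the two exponents.\<close>
  moreover have "(\<lambda>B. p B * minor S B ^ N) \<in> matpoly" "(\<lambda>B. q B * minor S B ^ M) \<in> matpoly"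
    using mat_poly_minor_power_mult[OF S(1)] p(1) q(1) by auto
  moreover have "q B * minor S B ^ M \<noteq> 0 \<and>
    f (colspan x B) = (p B * minor S B ^ N) / (q B * minor S B ^ M)" if "B \<in> ?Z" for B
  proof -
    from that have B: "B \<in> full_rank n r" "colspan x B \<in> basic_open S h"
      by (auto simp: gr_preimage_def)
    then have nz: "minor S B \<noteq> 0" "h (colspan x B) \<noteq> 0"
      using colspan_in_chart_iff[OF B(1) S(1)] by (auto simp: basic_open_def)
    then show ?thesis
      using ah(5)[OF B(2)] p(2)[OF B(1) nz(1)] q(2)[OF B(1) nz(1)] by (auto simp: field_simps)
  qed
  ultimately show "\<exists>Z. \<exists>a \<in> matpoly. \<exists>b \<in> matpoly.
    mat_open n r Z \<and> A \<in> Z \<and> Z \<subseteq> gr_preimage x n r W \<and>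
    (\<forall>B\<in>Z. b B \<noteq> 0 \<and> f (colspan x B) = a B / b B)"
    by (intro exI[of _ ?Z] bexI[of _ "\<lambda>B. p B * minor S B ^ N"]
        bexI[of _ "\<lambda>B. q B * minor S B ^ M"]) simp_all
qed

text \<open>The detour through \<open>OGr\<close>, whose definition mentions no chart: a fraction in
  \<open>S\<close> is a section of the structure sheaf over its principal open set, and such a
  section is a fraction in \<open>S'\<close>.\<close>

lemma regular_at_change:
  assumes S: "index_set S" "index_set S'" and f: "regular_at S f U" and U: "U \<in> ch S'"
  shows "regular_at S' f U"
proof -
  obtain a h where ah: "a \<in> cr S" "h \<in> cr S" "U \<in> basic_open S h"
    "\<And>U'. U' \<in> basic_open S h \<Longrightarrow> f U' = inverse (h U') * a U'"
    using f unfolding regular_at_def by blast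
  note op = gr_open_basic_open[OF S(1) ah(2)]
  have "restrict f (basic_open S h) \<in> OGr x n r (basic_open S h)"
  proof (rule regular_at_OGr[OF op])
    fix U' assume U': "U' \<in> basic_open S h"
    have "regular_at S f U'" unfolding regular_at_def using ah U' by blast
    then have "regular_at S (restrict f (basic_open S h)) U'"
      by (rule regular_at_cong[OF S(1) _ op U']) simp
    with S show "\<exists>T. index_set T \<and> regular_at T (restrict f (basic_open S h)) U'"
      by blast
  qed simp
  then have "regular_at S' (restrict f (basic_open S h)) U"
    by (rule OGr_regular_at[OF S(2) _ ah(3) U])
  then show ?thesis by (rule regular_at_cong[OF S(2) _ op ah(3)]) simp
qed

end

section \<open>Gluing submodules given on the charts\<close>

lemma tensor_zero: "(\<lambda>U\<in>X. 0) \<in> tensor act X R"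
proof -
  have "(\<lambda>U\<in>X. 0) = (\<lambda>U\<in>X. \<Sum>t<(0::nat). kscale act (undefined t U) (undefined t))" by simp
  then show ?thesis unfolding tensor_def by blast
qed

lemma tensor_extensional: "s \<in> tensor act X R \<Longrightarrow> s \<in> extensional X"
  by (auto simp: tensor_def)

lemma tensor_add_simple:
  assumes "s \<in> tensor act X R" "g \<in> R"
  shows "(\<lambda>U\<in>X. s U + kscale act (g U) v) \<in> tensor act X R"
proof -
  obtain N :: nat and f m where s: "s = (\<lambda>U\<in>X. \<Sum>t<N. kscale act (f t U) (m t))" "\<forall>t<N. f t \<in> R"
    using assms(1) unfolding tensor_def by blast
  have "(\<lambda>U\<in>X. s U + kscale act (g U) v) =
      (\<lambda>U\<in>X. \<Sum>t<Suc N. kscale act ((f(N := g)) t U) ((m(N := v)) t))"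
    by (simp add: s(1) fun_eq_iff)
  moreover have "\<forall>t<Suc N. (f(N := g)) t \<in> R" using s(2) assms(2) by (simp add: less_Suc_eq)
  ultimately show ?thesis unfolding tensor_def by blast
qed

text \<open>Adding the terms one at a time avoids splicing the index ranges of two sums.\<close>

lemma tensor_add_sum:
  fixes f :: "nat \<Rightarrow> _"
  assumes "s \<in> tensor act X R" "\<forall>t<N. f t \<in> R"
  shows "(\<lambda>U\<in>X. s U + (\<Sum>t<N. kscale act (f t U) (m t))) \<in> tensor act X R"
  using assms(2)
proof (induction N)
  case 0
  have "(\<lambda>U\<in>X. s U) = s" using tensor_extensional[OF assms(1)] by (rule extensional_restrict)
  then show ?case using assms(1) by simp
next
  case (Suc N)
  have "(\<lambda>U\<in>X. s U + (\<Sum>t<N. kscale act (f t U) (m t))) \<in> tensor act X R"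
    by (rule Suc.IH) (use Suc.prems in simp)
  moreover have "f N \<in> R" using Suc.prems by simp
  ultimately have "(\<lambda>U\<in>X. (\<lambda>U\<in>X. s U + (\<Sum>t<N. kscale act (f t U) (m t))) U +
      kscale act (f N U) (m N)) \<in> tensor act X R"
    by (rule tensor_add_simple)
  then show ?case
    by (simp add: restrict_def add.assoc cong: if_cong)
qed

lemma tensor_add:
  assumes "s \<in> tensor act X R" "t \<in> tensor act X R"
  shows "(\<lambda>U\<in>X. s U + t U) \<in> tensor act X R"
proof -
  obtain N :: nat and f m where t: "t = (\<lambda>U\<in>X. \<Sum>t<N. kscale act (f t U) (m t))" "\<forall>t<N. f t \<in> R"
    using assms(2) unfolding tensor_def by blast
  from tensor_add_sum[OF assms(1) t(2), of m] show ?thesis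
    by (simp add: t(1) restrict_def cong: if_cong)
qed

lemma tensor_sum_finite:
  assumes "finite I" "\<And>i. i \<in> I \<Longrightarrow> f i \<in> R"
  shows "(\<lambda>U\<in>X. \<Sum>i\<in>I. kscale act (f i U) (m i)) \<in> tensor act X R"
proof -
  obtain e where e: "bij_betw e {..<card I} I"
    using ex_bij_betw_nat_finite[OF assms(1)] by (auto simp: atLeast0LessThan)
  have "(\<lambda>U\<in>X. \<Sum>i\<in>I. kscale act (f i U) (m i)) =
      (\<lambda>U\<in>X. \<Sum>t<card I. kscale act (f (e t) U) (m (e t)))"
    by (intro restrict_ext sum.reindex_bij_betw[OF e, symmetric])
  moreover have "\<forall>t<card I. f (e t) \<in> R" using assms(2) bij_betwE[OF e] by auto
  ultimately show ?thesis
    unfolding tensor_def by (intro CollectI exI[of _ "card I"] exI[of _ "\<lambda>t. f (e t)"] exI[of _ "\<lambda>t. m (e t)"]) simp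
qed

locale grassmannian_module = grassmannian V x n r
  for V :: "('e::ab_group_add \<Rightarrow>\<^sub>0 'k::field) set" and x n r +
  fixes act :: "('e \<Rightarrow>\<^sub>0 'k) \<Rightarrow> 'm::ab_group_add \<Rightarrow> 'm"
  assumes module: "Modules.module act"
begin

sublocale M: Modules.module act by (rule module)

sublocale kM: Vector_Spaces.vector_space "kscale act"
  by (rule kscale_vector_space[OF module])

lemma act_kscale: "act a (kscale act c m) = kscale act c (act a m)"
  by (simp add: kscale_def mult.commute)

lemma act_kscale_left: "act (kscale (*) c a) m = kscale act c (act a m)"
  by (simp add: kscale_def)

abbreviation "CM \<equiv> chart_module act V x n r"

lemma tensor_scale:
  assumes s: "s \<in> tensor act X R" and g: "\<And>f. f \<in> R \<Longrightarrow> (\<lambda>U\<in>X. g U * f U) \<in> R"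
  shows "(\<lambda>U\<in>X. kscale act (g U) (s U)) \<in> tensor act X R"
proof -
  obtain N :: nat and f m where s: "s = (\<lambda>U\<in>X. \<Sum>t<N. kscale act (f t U) (m t))" "\<forall>t<N. f t \<in> R"
    using s unfolding tensor_def by blast
  have "(\<lambda>U\<in>X. kscale act (g U) (s U)) =
      (\<lambda>U\<in>X. \<Sum>t<N. kscale act ((\<lambda>U\<in>X. g U * f t U) U) (m t))"
    by (auto simp: s(1) kM.scale_sum_right)
  moreover have "\<forall>t<N. (\<lambda>U\<in>X. g U * f t U) \<in> R" using s(2) g by blast
  ultimately show ?thesis
    unfolding tensor_def
    by (intro CollectI exI[of _ N] exI[of _ "\<lambda>t. \<lambda>U\<in>X. g U * f t U"] exI[of _ m]) simp
qed

section \<open>Fractions with numerators in a submodule over a chart\<close>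

definition chart_submodule :: "nat set \<Rightarrow> (('e \<Rightarrow>\<^sub>0 'k) set \<Rightarrow> 'm) set \<Rightarrow> bool" where
  "chart_submodule S N \<longleftrightarrow> N \<subseteq> CM S \<and> (\<lambda>U\<in>ch S. 0) \<in> N \<and>
     (\<forall>a\<in>N. \<forall>b\<in>N. (\<lambda>U\<in>ch S. a U + b U) \<in> N) \<and>
     (\<forall>h\<in>cr S. \<forall>a\<in>N. (\<lambda>U\<in>ch S. kscale act (h U) (a U)) \<in> N)"

lemma chart_submoduleD:
  assumes "chart_submodule S N"
  shows "N \<subseteq> CM S" "(\<lambda>U\<in>ch S. 0) \<in> N"
    "\<And>a b. a \<in> N \<Longrightarrow> b \<in> N \<Longrightarrow> (\<lambda>U\<in>ch S. a U + b U) \<in> N"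
    "\<And>h a. h \<in> cr S \<Longrightarrow> a \<in> N \<Longrightarrow> (\<lambda>U\<in>ch S. kscale act (h U) (a U)) \<in> N"
  using assms by (auto simp: chart_submodule_def)

lemma chart_submodule_chart_module: "chart_submodule S (CM S)"
  by (auto simp: chart_submodule_def tensor_zero intro: tensor_add tensor_scale chart_ring_mult)

text \<open>The module counterpart of \<open>regular_at\<close>: the germ of s at U lies in the
  localisation of \<open>N\<close> at U, realised by functions.\<close>

definition frac_at ::
    "nat set \<Rightarrow> (('e \<Rightarrow>\<^sub>0 'k) set \<Rightarrow> 'm) set \<Rightarrow> (('e \<Rightarrow>\<^sub>0 'k) set \<Rightarrow> 'm) \<Rightarrow> ('e \<Rightarrow>\<^sub>0 'k) set \<Rightarrow> bool" where
  "frac_at S N s U \<longleftrightarrow> (\<exists>a\<in>N. \<exists>h\<in>cr S. U \<in> basic_open S h \<and>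
     (\<forall>U'\<in>basic_open S h. s U' = kscale act (inverse (h U')) (a U')))"

lemma frac_at_shrink:
  assumes S: "index_set S" and N: "chart_submodule S N" and s: "frac_at S N s U"
    and W: "gopen W" "U \<in> W"
  obtains a h where "a \<in> N" "h \<in> cr S" "U \<in> basic_open S h" "basic_open S h \<subseteq> W"
    "\<And>U'. U' \<in> basic_open S h \<Longrightarrow> s U' = kscale act (inverse (h U')) (a U')"
proof -
  obtain a h where ah: "a \<in> N" "h \<in> cr S" "U \<in> basic_open S h"
    "\<And>U'. U' \<in> basic_open S h \<Longrightarrow> s U' = kscale act (inverse (h U')) (a U')"
    using s unfolding frac_at_def by blast
  obtain g where g: "g \<in> cr S" "U \<in> basic_open S g" "basic_open S g \<subseteq> W"
    using basic_open_base[OF S W] ah(3) by (auto simp: basic_open_def)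
  show ?thesis
  proof (rule that[OF chart_submoduleD(4)[OF N g(1) ah(1)] chart_ring_mult[OF ah(2) g(1)]])
    show "U \<in> basic_open S (\<lambda>U\<in>ch S. h U * g U)" "basic_open S (\<lambda>U\<in>ch S. h U * g U) \<subseteq> W"
      using ah(3) g by (auto simp: basic_open_mult)
    fix U' assume "U' \<in> basic_open S (\<lambda>U\<in>ch S. h U * g U)"
    then have "U' \<in> basic_open S h" "U' \<in> ch S" "h U' \<noteq> 0" "g U' \<noteq> 0"
      by (auto simp: basic_open_mult basic_open_def)
    then show "s U' = kscale act (inverse ((\<lambda>U\<in>ch S. h U * g U) U'))
        ((\<lambda>U\<in>ch S. kscale act (g U) (a U)) U')"
      using ah(4) by simp
  qed
qed

lemma frac_at_cong:
  assumes "index_set S" "chart_submodule S N" "frac_at S N s U" "gopen W" "U \<in> W"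
    "\<And>U'. U' \<in> W \<Longrightarrow> s U' = t U'"
  shows "frac_at S N t U"
proof -
  obtain a h where "a \<in> N" "h \<in> cr S" "U \<in> basic_open S h" "basic_open S h \<subseteq> W"
    "\<And>U'. U' \<in> basic_open S h \<Longrightarrow> s U' = kscale act (inverse (h U')) (a U')"
    by (rule frac_at_shrink[OF assms(1-5)]) blast
  then show ?thesis unfolding frac_at_def using assms(6) by (metis subsetD)
qed

lemma frac_at_member:
  assumes "a \<in> N" "U \<in> ch S"
  shows "frac_at S N a U"
  unfolding frac_at_def
proof (intro bexI[OF _ assms(1)] bexI[OF _ chart_ring_const[of 1]] conjI ballI)
  show "U \<in> basic_open S (\<lambda>U\<in>ch S. 1)" using assms(2) by (simp add: basic_open_def)
  fix U' assume "U' \<in> basic_open S (\<lambda>U\<in>ch S. 1)"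
  then show "a U' = kscale act (inverse ((\<lambda>U\<in>ch S. 1) U')) (a U')"
    by (simp add: basic_open_def)
qed

lemma frac_at_zero:
  assumes "chart_submodule S N" "U \<in> ch S"
  shows "frac_at S N (\<lambda>_. 0) U"
proof -
  obtain a h where ah: "a \<in> N" "h \<in> cr S" "U \<in> basic_open S h"
    "\<And>U'. U' \<in> basic_open S h \<Longrightarrow> (\<lambda>U\<in>ch S. 0) U' = kscale act (inverse (h U')) (a U')"
    using frac_at_member[OF chart_submoduleD(2)[OF assms(1)] assms(2)] unfolding frac_at_def by blast
  then have "0 = kscale act (inverse (h U')) (a U')" if "U' \<in> basic_open S h" for U'
    using that by (auto simp: basic_open_def)
  with ah show ?thesis unfolding frac_at_def by blast
qed

lemma frac_at_add:
  assumes N: "chart_submodule S N" and s: "frac_at S N s U" and t: "frac_at S N t U"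
  shows "frac_at S N (\<lambda>U. s U + t U) U"
proof -
  obtain a h where ah: "a \<in> N" "h \<in> cr S" "U \<in> basic_open S h"
    "\<And>U'. U' \<in> basic_open S h \<Longrightarrow> s U' = kscale act (inverse (h U')) (a U')"
    using s unfolding frac_at_def by blast
  obtain b g where bg: "b \<in> N" "g \<in> cr S" "U \<in> basic_open S g"
    "\<And>U'. U' \<in> basic_open S g \<Longrightarrow> t U' = kscale act (inverse (g U')) (b U')"
    using t unfolding frac_at_def by blast
  define c where "c = (\<lambda>U\<in>ch S. (\<lambda>U\<in>ch S. kscale act (g U) (a U)) U + (\<lambda>U\<in>ch S. kscale act (h U) (b U)) U)"
  have "c \<in> N"
    unfolding c_def by (intro chart_submoduleD(3,4)[OF N] ah(1,2) bg(1,2))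
  moreover have "(\<lambda>U\<in>ch S. h U * g U) \<in> cr S" by (rule chart_ring_mult[OF ah(2) bg(2)])
  moreover have "U \<in> basic_open S (\<lambda>U\<in>ch S. h U * g U)" using ah(3) bg(3) by (simp add: basic_open_mult)
  moreover have "s U' + t U' = kscale act (inverse ((\<lambda>U\<in>ch S. h U * g U) U')) (c U')"
    if "U' \<in> basic_open S (\<lambda>U\<in>ch S. h U * g U)" for U'
  proof -
    have "U' \<in> basic_open S h" "U' \<in> basic_open S g" "U' \<in> ch S" "h U' \<noteq> 0" "g U' \<noteq> 0"
      using that by (auto simp: basic_open_mult basic_open_def)
    moreover from this have "inverse (h U' * g U') * g U' = inverse (h U')"
        "inverse (h U' * g U') * h U' = inverse (g U')"
      by (simp_all add: field_simps)
    ultimately show ?thesis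
      by (simp add: ah(4) bg(4) c_def kM.scale_right_distrib del: inverse_mult_distrib)
  qed
  ultimately show ?thesis unfolding frac_at_def by blast
qed

lemma frac_at_sum:
  assumes N: "chart_submodule S N" and U: "U \<in> ch S" and s: "\<And>i. i \<in> I \<Longrightarrow> frac_at S N (s i) U"
  shows "frac_at S N (\<lambda>U. \<Sum>i\<in>I. s i U) U"
  using s
proof (induction I rule: infinite_finite_induct)
  case (insert i I)
  then have "frac_at S N (\<lambda>U. s i U + (\<Sum>i\<in>I. s i U)) U" by (intro frac_at_add[OF N]) auto
  then show ?case using insert by simp
qed (simp_all add: frac_at_zero[OF N U])

lemma frac_at_scale:
  assumes N: "chart_submodule S N" and f: "regular_at S f U" and s: "frac_at S N s U"
  shows "frac_at S N (\<lambda>U. kscale act (f U) (s U)) U"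
proof -
  obtain a h where ah: "a \<in> N" "h \<in> cr S" "U \<in> basic_open S h"
    "\<And>U'. U' \<in> basic_open S h \<Longrightarrow> s U' = kscale act (inverse (h U')) (a U')"
    using s unfolding frac_at_def by blast
  obtain b g where bg: "b \<in> cr S" "g \<in> cr S" "U \<in> basic_open S g"
    "\<And>U'. U' \<in> basic_open S g \<Longrightarrow> f U' = inverse (g U') * b U'"
    using f unfolding regular_at_def by blast
  have "(\<lambda>U\<in>ch S. kscale act (b U) (a U)) \<in> N" by (rule chart_submoduleD(4)[OF N bg(1) ah(1)])
  moreover have "(\<lambda>U\<in>ch S. h U * g U) \<in> cr S" by (rule chart_ring_mult[OF ah(2) bg(2)])
  moreover have "U \<in> basic_open S (\<lambda>U\<in>ch S. h U * g U)" using ah(3) bg(3) by (simp add: basic_open_mult)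
  moreover have "kscale act (f U') (s U') = kscale act (inverse ((\<lambda>U\<in>ch S. h U * g U) U'))
      ((\<lambda>U\<in>ch S. kscale act (b U) (a U)) U')"
    if "U' \<in> basic_open S (\<lambda>U\<in>ch S. h U * g U)" for U'
  proof -
    have "U' \<in> basic_open S h" "U' \<in> basic_open S g" "U' \<in> ch S" "h U' \<noteq> 0" "g U' \<noteq> 0"
      using that by (auto simp: basic_open_mult basic_open_def)
    then show ?thesis
      by (simp add: ah(4) bg(4) ac_simps)
  qed
  ultimately show ?thesis unfolding frac_at_def by blast
qed

lemma regular_at_chart_ring:
  assumes "f \<in> cr S" "U \<in> ch S"
  shows "regular_at S f U"
  unfolding regular_at_def
  by (intro bexI[OF _ assms(1)] bexI[OF _ chart_ring_const[of 1]])
    (use assms(2) in \<open>auto simp: basic_open_def\<close>)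

lemma regular_at_inverse:
  assumes "h \<in> cr S" "U \<in> basic_open S h"
  shows "regular_at S (\<lambda>U. inverse (h U)) U"
  unfolding regular_at_def
  by (intro bexI[OF _ chart_ring_const[of 1]] bexI[OF _ assms(1)])
    (use assms(2) in \<open>auto simp: basic_open_def\<close>)

text \<open>Constant sections exist over every chart, and the coefficients of a change chart by
  \<open>regular_at_change\<close>; sums and multiples do the rest.\<close>

lemma frac_at_chart_module_change:
  assumes S: "index_set S" "index_set S'" and a: "a \<in> CM S" and U: "U \<in> ch S" "U \<in> ch S'"
  shows "frac_at S' (CM S') a U"
proof -
  obtain N :: nat and f m where a: "a = (\<lambda>U\<in>ch S. \<Sum>t<N. kscale act (f t U) (m t))"
      "\<forall>t<N. f t \<in> cr S"
    using a unfolding tensor_def by blast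
  note CM' = chart_submodule_chart_module[of S']
  have c0: "(\<lambda>U\<in>ch S'. m t) \<in> CM S'" for t
  proof -
    have "(\<lambda>U\<in>ch S'. (\<lambda>U\<in>ch S'. 0) U + kscale act ((\<lambda>U\<in>ch S'. 1) U) (m t)) \<in> CM S'"
      by (intro tensor_add_simple tensor_zero chart_ring_const)
    then show ?thesis by (simp add: restrict_def cong: if_cong)
  qed
  have const: "frac_at S' (CM S') (\<lambda>_. m t) U" for t
    by (rule frac_at_cong[OF S(2) CM' frac_at_member[OF c0[of t] U(2)] gr_open_chart[OF S(2)] U(2)]) simp
  have "frac_at S' (CM S') (\<lambda>U. \<Sum>t<N. kscale act (f t U) (m t)) U"
    using a(2) by (intro frac_at_sum[OF CM' U(2)] frac_at_scale[OF CM' _ const]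
        regular_at_change[OF S regular_at_chart_ring U(2)] U(1)) auto
  then show ?thesis
    by (rule frac_at_cong[OF S(2) CM' _ gr_open_chart[OF S(1)] U(1)]) (simp add: a(1))
qed

text \<open>In \<open>assoc_sheaf\<close> the set \<open>Z\<close> may be smaller than the
  nonvanishing locus of the denominator. The fraction itself satisfies \<open>frac_at\<close>, and s
  need only agree with it on the open set \<open>Z\<close>; conversely a fraction can be shrunk into
  \<open>W\<close>.\<close>

lemma assoc_sheaf_iff:
  assumes S: "index_set S" and N: "chart_submodule S N" and W: "gopen W" "W \<subseteq> ch S"
  shows "s \<in> assoc_sheaf act V x n r S N W \<longleftrightarrow>
    s \<in> extensional W \<and> (\<forall>U\<in>W. frac_at S N s U)"
proof (intro iffI conjI ballI)
  assume "s \<in> assoc_sheaf act V x n r S N W"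
  then have s: "s \<in> extensional W" "\<forall>U\<in>W. \<exists>Z. \<exists>a\<in>N. \<exists>f\<in>cr S. gopen Z \<and> U \<in> Z \<and> Z \<subseteq> W \<and>
       (\<forall>U'\<in>Z. f U' \<noteq> 0 \<and> s U' = kscale act (inverse (f U')) (a U'))"
    by (simp_all add: assoc_sheaf_def)
  show "s \<in> extensional W" by (rule s)
  fix U assume U: "U \<in> W"
  then obtain Z a f where Z: "a \<in> N" "f \<in> cr S" "gopen Z" "U \<in> Z" "Z \<subseteq> W"
      "\<And>U'. U' \<in> Z \<Longrightarrow> f U' \<noteq> 0 \<and> s U' = kscale act (inverse (f U')) (a U')"
    using s(2) by metis
  have "frac_at S N (\<lambda>U. kscale act (inverse (f U)) (a U)) U"
  proof (rule frac_at_scale[OF N regular_at_inverse[OF Z(2)] frac_at_member[OF Z(1)]])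
    show "U \<in> ch S" using U W(2) by blast
    then show "U \<in> basic_open S f" using Z(6)[OF Z(4)] by (simp add: basic_open_def)
  qed
  then show "frac_at S N s U" by (rule frac_at_cong[OF S N _ Z(3,4)]) (simp add: Z(6))
next
  assume s: "s \<in> extensional W \<and> (\<forall>U\<in>W. frac_at S N s U)"
  show "s \<in> assoc_sheaf act V x n r S N W"
    unfolding assoc_sheaf_def
  proof (intro CollectI conjI ballI)
    fix U assume U: "U \<in> W"
    obtain a h where ah: "a \<in> N" "h \<in> cr S" "U \<in> basic_open S h" "basic_open S h \<subseteq> W"
      "\<And>U'. U' \<in> basic_open S h \<Longrightarrow> s U' = kscale act (inverse (h U')) (a U')"
      using s U by (auto intro: frac_at_shrink[OF S N _ W(1) U])
    then have "\<forall>U'\<in>basic_open S h. h U' \<noteq> 0 \<and> s U' = kscale act (inverse (h U')) (a U')"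
      by (auto simp: basic_open_def)
    then show "\<exists>Z. \<exists>a\<in>N. \<exists>f\<in>cr S. gopen Z \<and> U \<in> Z \<and> Z \<subseteq> W \<and>
       (\<forall>U'\<in>Z. f U' \<noteq> 0 \<and> s U' = kscale act (inverse (f U')) (a U'))"
      using ah(1-4) gr_open_basic_open[OF S ah(2)] by blast
  qed (use s in simp)
qed

text \<open>Fractions chosen near different points have no common expression as a finite sum, but
  the coordinates of s in a finite basis of \<open>M\<close> are functions on all of
  \<open>W\<close>, and being regular is local. This is where finite dimension enters.\<close>

lemma frac_at_tensor:
  assumes fd: "finite_dimensional_vector_space (kscale act) B"
    and W: "gopen W" and s: "s \<in> extensional W"
    and frac: "\<And>S U. index_set S \<Longrightarrow> U \<in> W \<Longrightarrow> U \<in> ch S \<Longrightarrow> frac_at S (CM S) s U"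
  shows "s \<in> tensor act W (OGr x n r W)"
proof -
  interpret fd: finite_dimensional_vector_space "kscale act" B by (rule fd)
  note B = fd.independent_Basis fd.finite_Basis fd.span_Basis
  define f where "f b = (\<lambda>U\<in>W. kM.representation B (s U) b)" for b
  have "f b \<in> OGr x n r W" for b
  proof (rule regular_at_OGr[OF W])
    fix U assume U: "U \<in> W"
    then obtain S where S: "index_set S" "U \<in> ch S" using ex_chart gr_open_Grass[OF W] by blast
    obtain a h where ah: "a \<in> CM S" "h \<in> cr S" "U \<in> basic_open S h" "basic_open S h \<subseteq> W"
      "\<And>U'. U' \<in> basic_open S h \<Longrightarrow> s U' = kscale act (inverse (h U')) (a U')"
      by (rule frac_at_shrink[OF S(1) chart_submodule_chart_module frac[OF S(1) U S(2)] W U]) blast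
    obtain N :: nat and g m where g: "a = (\<lambda>U\<in>ch S. \<Sum>t<N. kscale act (g t U) (m t))"
        "\<forall>t<N. g t \<in> cr S"
      using ah(1) unfolding tensor_def by blast
    \<comment> \<open>The b-coordinate of the numerator a: the coordinates of the vectors
      \<open>m t\<close> are constants, so c stays in the coordinate ring.\<close>
    define c where "c = (\<lambda>U\<in>ch S. \<Sum>t<N. (\<lambda>U\<in>ch S. g t U * (\<lambda>U\<in>ch S. kM.representation B (m t) b) U) U)"
    have "c \<in> cr S"
      unfolding c_def using g(2) by (intro chart_ring_sum chart_ring_mult chart_ring_const) auto
    moreover have "f b U' = inverse (h U') * c U'" if U': "U' \<in> basic_open S h" for U'
    proof -
      have "U' \<in> ch S" "U' \<in> W" using U' ah(4) by (auto simp: basic_open_def)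
      then show ?thesis
        using B by (simp add: f_def ah(5)[OF U'] g(1) c_def kM.representation_scale
            kM.representation_sum)
    qed
    ultimately have "regular_at S (f b) U" unfolding regular_at_def using ah(2,3) by blast
    with S(1) show "\<exists>S. index_set S \<and> regular_at S (f b) U" by blast
  qed (simp add: f_def)
  then have "(\<lambda>U\<in>W. \<Sum>b\<in>B. kscale act (f b U) b) \<in> tensor act W (OGr x n r W)"
    by (intro tensor_sum_finite[OF B(2)])
  moreover have "(\<lambda>U\<in>W. \<Sum>b\<in>B. kscale act (f b U) b) = s"
  proof
    fix U
    have "(\<Sum>b\<in>B. kscale act (kM.representation B (s U) b) b) = s U"
      using kM.sum_representation_eq[OF B(1) _ B(2) order.refl, of "s U"] B(3) by simp
    then show "(\<lambda>U\<in>W. \<Sum>b\<in>B. kscale act (f b U) b) U = s U"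
      using s by (auto simp: f_def extensional_def)
  qed
  ultimately show ?thesis by simp
qed

lemma frac_at_mono: "N \<subseteq> N' \<Longrightarrow> frac_at S N s U \<Longrightarrow> frac_at S N' s U"
  unfolding frac_at_def by blast

section \<open>Uniqueness and existence of the glued sheaf\<close>

lemma module_subsheafD:
  assumes "module_subsheaf act V x n r F"
  shows "gopen W \<Longrightarrow> F W \<subseteq> tensor act W (OGr x n r W)"
    and "gopen W \<Longrightarrow> gopen W' \<Longrightarrow> W' \<subseteq> W \<Longrightarrow> s \<in> F W \<Longrightarrow> restrict s W' \<in> F W'"
    and "(\<forall>W\<in>C. gopen W \<and> t W \<in> F W) \<Longrightarrow>
      (\<forall>W\<in>C. \<forall>W'\<in>C. restrict (t W) (W \<inter> W') = restrict (t W') (W \<inter> W')) \<Longrightarrow>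
      \<exists>!s. s \<in> F (\<Union>C) \<and> (\<forall>W\<in>C. restrict s W = t W)"
proof -
  note F = assms[unfolded module_subsheaf_def, THEN conjunct2]
  show "gopen W \<Longrightarrow> F W \<subseteq> tensor act W (OGr x n r W)"
    using F[THEN conjunct1] by blast
  show "gopen W \<Longrightarrow> gopen W' \<Longrightarrow> W' \<subseteq> W \<Longrightarrow> s \<in> F W \<Longrightarrow> restrict s W' \<in> F W'"
    using F[THEN conjunct2, THEN conjunct1] by blast
  show "\<exists>!s. s \<in> F (\<Union>C) \<and> (\<forall>W\<in>C. restrict s W = t W)"
    if "\<forall>W\<in>C. gopen W \<and> t W \<in> F W"
      "\<forall>W\<in>C. \<forall>W'\<in>C. restrict (t W) (W \<inter> W') = restrict (t W') (W \<inter> W')"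
    using F[THEN conjunct2, THEN conjunct2, THEN spec, THEN spec, THEN mp, OF conjI, OF that] .
qed

text \<open>The pieces of s on the intersections of \<open>W\<close> with the charts lie in
  \<open>G\<close> and glue there to a section, which can only be s. Applied both ways, this is
  uniqueness.\<close>

lemma module_subsheaf_subset:
  assumes F: "module_subsheaf act V x n r F" and G: "module_subsheaf act V x n r G"
    and FG: "\<And>S W. index_set S \<Longrightarrow> gopen W \<Longrightarrow> W \<subseteq> ch S \<Longrightarrow> F W \<subseteq> G W"
    and W: "gopen W"
  shows "F W \<subseteq> G W"
proof
  fix s assume s: "s \<in> F W"
  define C where "C = (\<lambda>S. W \<inter> ch S) ` {S. index_set S}"
  have C: "\<Union>C = W"
  proof
    show "W \<subseteq> \<Union>C"
    proof
      fix U assume "U \<in> W"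
      then obtain S where "index_set S" "U \<in> ch S"
        using ex_chart[of U] gr_open_Grass[OF W] by blast
      with \<open>U \<in> W\<close> show "U \<in> \<Union>C" by (auto simp: C_def)
    qed
  qed (auto simp: C_def)
  have C_open: "gopen W'" if "W' \<in> C" for W'
    using that gr_open_Int[OF W gr_open_chart] by (auto simp: C_def)
  have rG: "restrict s W' \<in> G W'" if W': "W' \<in> C" for W'
  proof -
    have "W' \<subseteq> W" using W' by (auto simp: C_def)
    then have "restrict s W' \<in> F W'"
      using module_subsheafD(2)[OF F W C_open[OF W'] _ s] by simp
    moreover obtain S where "index_set S" "W' \<subseteq> ch S" using W' by (auto simp: C_def)
    ultimately show ?thesis using FG[OF _ C_open[OF W']] by blast
  qed
  have "\<exists>!u. u \<in> G (\<Union>C) \<and> (\<forall>W'\<in>C. restrict u W' = restrict s W')"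
  proof (rule module_subsheafD(3)[OF G])
    show "\<forall>W\<in>C. gopen W \<and> restrict s W \<in> G W" using rG C_open by blast
    show "\<forall>W\<in>C. \<forall>W'\<in>C. restrict (restrict s W) (W \<inter> W') = restrict (restrict s W') (W \<inter> W')"
      by (auto simp: fun_eq_iff)
  qed
  then obtain u where u: "u \<in> G W" "\<And>W'. W' \<in> C \<Longrightarrow> restrict u W' = restrict s W'"
    unfolding C by blast
  have ext: "s \<in> extensional W" "u \<in> extensional W"
    using module_subsheafD(1)[OF F W] module_subsheafD(1)[OF G W] s u(1) tensor_extensional by blast+
  have "u = s"
  proof (rule extensionalityI[OF ext(2,1)])
    fix U assume "U \<in> W"
    then obtain W' where "W' \<in> C" "U \<in> W'" using C by blast
    then show "u U = s U" using fun_cong[OF u(2), of W' U] by simp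
  qed
  with u(1) show "s \<in> G W" by simp
qed

theorem ex1_module_subsheaf:
  assumes fd: "finite_dimensional_vector_space (kscale act) B"
    and N: "\<And>S. index_set S \<Longrightarrow> chart_submodule S (N S)"
    and compat: "\<And>S S' a U. index_set S \<Longrightarrow> index_set S' \<Longrightarrow> a \<in> N S \<Longrightarrow> U \<in> ch S \<Longrightarrow> U \<in> ch S' \<Longrightarrow>
      frac_at S' (N S') a U"
  shows "\<exists>!F. module_subsheaf act V x n r F \<and>
    (\<forall>S. S \<subseteq> {..<n} \<and> card S = r \<longrightarrow> restricts_to act V x n r F S (N S))"
proof (rule ex_ex1I)
  \<comment> \<open>Only the numerator needs the hypothesis \<open>compat\<close>; the inverse of
    the denominator is regular at U in both charts.\<close>
  have change: "frac_at S' (N S') s U"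
    if S: "index_set S" "index_set S'" and s: "frac_at S (N S) s U" and U: "U \<in> ch S'" for S S' s U
  proof -
    obtain a h where ah: "a \<in> N S" "h \<in> cr S" "U \<in> basic_open S h"
      "\<And>U'. U' \<in> basic_open S h \<Longrightarrow> s U' = kscale act (inverse (h U')) (a U')"
      using s unfolding frac_at_def by blast
    have US: "U \<in> ch S" using ah(3) by (simp add: basic_open_def)
    have "frac_at S' (N S') (\<lambda>U. kscale act (inverse (h U)) (a U)) U"
      by (intro frac_at_scale[OF N[OF S(2)]] regular_at_change[OF S _ U]
          regular_at_inverse[OF ah(2,3)] compat[OF S ah(1) US U])
    then show ?thesis
      by (rule frac_at_cong[OF S(2) N[OF S(2)] _ gr_open_basic_open[OF S(1) ah(2)] ah(3)])
        (simp add: ah(4))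
  qed
  \<comment> \<open>Asking for all charts through U leaves no choice to track, so restriction and
    gluing are conditions at points. For the restriction to one chart, \<open>change\<close> reduces
    them to the condition in that chart.\<close>
  define F where "F = (\<lambda>W\<in>{W. gopen W}. {s \<in> extensional W.
    \<forall>U\<in>W. \<forall>S. index_set S \<longrightarrow> U \<in> ch S \<longrightarrow> frac_at S (N S) s U})"
  have F_iff: "s \<in> F W \<longleftrightarrow> s \<in> extensional W \<and>
      (\<forall>U\<in>W. \<forall>S. index_set S \<longrightarrow> U \<in> ch S \<longrightarrow> frac_at S (N S) s U)" if "gopen W" for W s
    using that by (simp add: F_def)
  have "module_subsheaf act V x n r F"
    unfolding module_subsheaf_def
  proof (intro conjI allI impI ballI)
    show "F \<in> extensional {W. gopen W}" by (simp add: F_def)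
  next
    fix W assume W: "gopen W"
    show "F W \<subseteq> tensor act W (OGr x n r W)"
    proof
      fix s assume s: "s \<in> F W"
      show "s \<in> tensor act W (OGr x n r W)"
      proof (rule frac_at_tensor[OF fd W])
        show "s \<in> extensional W" using s by (simp add: F_iff[OF W])
        fix S U assume "index_set S" "U \<in> W" "U \<in> ch S"
        then show "frac_at S (CM S) s U"
          using s frac_at_mono[OF chart_submoduleD(1)[OF N]] unfolding F_iff[OF W] by blast
      qed
    qed
    show "(\<lambda>U\<in>W. 0) \<in> F W"
      unfolding F_iff[OF W]
    proof (intro conjI ballI allI impI restrict_extensional)
      fix U S assume U: "U \<in> W" and S: "index_set S" and US: "U \<in> ch S"
      show "frac_at S (N S) (\<lambda>U\<in>W. 0) U"
        by (rule frac_at_cong[OF S N[OF S] frac_at_zero[OF N[OF S] US] W U]) simp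
    qed
    fix s assume s: "s \<in> F W"
    {
      fix t assume t: "t \<in> F W"
      show "(\<lambda>U\<in>W. s U + t U) \<in> F W"
        unfolding F_iff[OF W]
      proof (intro conjI ballI allI impI restrict_extensional)
        fix U S assume U: "U \<in> W" and S: "index_set S" and US: "U \<in> ch S"
        have "frac_at S (N S) (\<lambda>U. s U + t U) U"
          using s t U S US unfolding F_iff[OF W] by (intro frac_at_add[OF N[OF S]]) auto
        then show "frac_at S (N S) (\<lambda>U\<in>W. s U + t U) U"
          by (rule frac_at_cong[OF S N[OF S] _ W U]) simp
      qed
    }
    fix f assume f: "f \<in> OGr x n r W"
    show "(\<lambda>U\<in>W. kscale act (f U) (s U)) \<in> F W"
      unfolding F_iff[OF W]
    proof (intro conjI ballI allI impI restrict_extensional)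
      fix U S assume U: "U \<in> W" and S: "index_set S" and US: "U \<in> ch S"
      have "frac_at S (N S) s U" using s U S US unfolding F_iff[OF W] by blast
      then have "frac_at S (N S) (\<lambda>U. kscale act (f U) (s U)) U"
        by (rule frac_at_scale[OF N[OF S] OGr_regular_at[OF S f U US]])
      then show "frac_at S (N S) (\<lambda>U\<in>W. kscale act (f U) (s U)) U"
        by (rule frac_at_cong[OF S N[OF S] _ W U]) simp
    qed
  next
    fix W W' s
    assume W: "gopen W \<and> gopen W' \<and> W' \<subseteq> W" and s: "s \<in> F W"
    then have W': "gopen W'" "W' \<subseteq> W" by auto
    show "restrict s W' \<in> F W'"
      unfolding F_iff[OF W'(1)]
    proof (intro conjI ballI allI impI restrict_extensional)
      fix U S assume U: "U \<in> W'" and S: "index_set S" and US: "U \<in> ch S"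
      have "frac_at S (N S) s U" using s U S US W F_iff[of W] by blast
      then show "frac_at S (N S) (restrict s W') U"
        by (rule frac_at_cong[OF S N[OF S] _ W'(1) U]) simp
    qed
  next
    fix C t
    assume Ct: "(\<forall>W\<in>C. gopen W \<and> t W \<in> F W) \<and>
      (\<forall>W\<in>C. \<forall>W'\<in>C. restrict (t W) (W \<inter> W') = restrict (t W') (W \<inter> W'))"
    then have t: "\<And>W. W \<in> C \<Longrightarrow> gopen W" "\<And>W. W \<in> C \<Longrightarrow> t W \<in> F W" by auto
    have agree: "t W U = t W' U" if "W \<in> C" "W' \<in> C" "U \<in> W" "U \<in> W'" for W W' U
    proof -
      have "restrict (t W) (W \<inter> W') U = restrict (t W') (W \<inter> W') U" using Ct that by simp
      then show ?thesis using that by simp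
    qed
    have UC: "gopen (\<Union>C)" using t(1) by (rule gr_open_Union)
    have t_ext: "t W \<in> extensional W" if "W \<in> C" for W
      using t(2)[OF that] by (simp add: F_iff[OF t(1)[OF that]])
    \<comment> \<open>The value is taken from an arbitrary member of the cover containing U; by
      \<open>agree\<close> the choice does not matter.\<close>
    define s where "s = (\<lambda>U\<in>\<Union>C. t (SOME W. W \<in> C \<and> U \<in> W) U)"
    have s_eq: "s U = t W U" if "W \<in> C" "U \<in> W" for W U
    proof -
      define W0 where "W0 = (SOME W. W \<in> C \<and> U \<in> W)"
      have W0: "W0 \<in> C" "U \<in> W0"
        using someI[of "\<lambda>W. W \<in> C \<and> U \<in> W" W] that by (simp_all add: W0_def)
      have "U \<in> \<Union>C" using that by blast
      then have "s U = t W0 U" unfolding s_def W0_def by (rule restrict_apply')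
      also have "\<dots> = t W U" by (rule agree[OF W0(1) that(1) W0(2) that(2)])
      finally show ?thesis .
    qed
    show "\<exists>!s. s \<in> F (\<Union>C) \<and> (\<forall>W\<in>C. restrict s W = t W)"
    proof (intro ex1I[of _ s] conjI ballI)
      show "s \<in> F (\<Union>C)"
        unfolding F_iff[OF UC]
      proof (intro conjI ballI allI impI)
        show "s \<in> extensional (\<Union>C)" by (simp add: s_def)
        fix U S assume U: "U \<in> \<Union>C" "index_set S" "U \<in> ch S"
        then obtain W where W: "W \<in> C" "U \<in> W" by blast
        then have "frac_at S (N S) (t W) U" using t(2)[OF W(1)] U by (simp add: F_iff[OF t(1)])
        then show "frac_at S (N S) s U"
          by (rule frac_at_cong[OF U(2) N[OF U(2)] _ t(1)[OF W(1)] W(2)]) (rule s_eq[OF W(1), symmetric])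
      qed
      show "restrict s W = t W" if "W \<in> C" for W
        using t_ext[OF that] s_eq[OF that] by (auto simp: fun_eq_iff extensional_def)
      fix s' assume s': "s' \<in> F (\<Union>C) \<and> (\<forall>W\<in>C. restrict s' W = t W)"
      show "s' = s"
      proof (rule extensionalityI)
        show "s' \<in> extensional (\<Union>C)" using s' by (simp add: F_iff[OF UC])
        show "s \<in> extensional (\<Union>C)" by (simp add: s_def)
        fix U assume "U \<in> \<Union>C"
        then obtain W where W: "W \<in> C" "U \<in> W" by blast
        then have "restrict s' W U = t W U" using s' by simp
        then show "s' U = s U" using W s_eq by simp
      qed
    qed
  qed
  moreover have "restricts_to act V x n r F S (N S)" if "S \<subseteq> {..<n} \<and> card S = r" for S
    unfolding restricts_to_def
  proof (intro allI impI)
    have S: "index_set S" using that by (simp add: index_set_def)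
    fix W assume "gopen W \<and> W \<subseteq> ch S"
    then have W: "gopen W" "W \<subseteq> ch S" by auto
    show "F W = assoc_sheaf act V x n r S (N S) W"
    proof (rule Set.set_eqI)
      fix s
      have "(\<forall>U\<in>W. \<forall>S. index_set S \<longrightarrow> U \<in> ch S \<longrightarrow> frac_at S (N S) s U) \<longleftrightarrow>
          (\<forall>U\<in>W. frac_at S (N S) s U)"
        using change[OF S] S W(2) by blast
      then show "s \<in> F W \<longleftrightarrow> s \<in> assoc_sheaf act V x n r S (N S) W"
        by (simp add: F_iff[OF W(1)] assoc_sheaf_iff[OF S N[OF S] W])
    qed
  qed
  ultimately show "\<exists>F. module_subsheaf act V x n r F \<and>
      (\<forall>S. S \<subseteq> {..<n} \<and> card S = r \<longrightarrow> restricts_to act V x n r F S (N S))"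
    by blast
next
  fix F G
  assume F: "module_subsheaf act V x n r F \<and>
      (\<forall>S. S \<subseteq> {..<n} \<and> card S = r \<longrightarrow> restricts_to act V x n r F S (N S))"
    and G: "module_subsheaf act V x n r G \<and>
      (\<forall>S. S \<subseteq> {..<n} \<and> card S = r \<longrightarrow> restricts_to act V x n r G S (N S))"
  have FG: "F W = G W" if "index_set S" "gopen W" "W \<subseteq> ch S" for S W
    using F G that by (simp add: restricts_to_def index_set_def)
  show "F = G"
  proof (rule extensionalityI[of _ "{W. gopen W}"])
    show "F \<in> extensional {W. gopen W}" "G \<in> extensional {W. gopen W}"
      using F G by (simp_all add: module_subsheaf_def)
    fix W assume "W \<in> {W. gopen W}"
    then show "F W = G W"
      using module_subsheaf_subset[of F G W] module_subsheaf_subset[of G F W] F G FG by simp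
  qed
qed

subsection \<open>Kernels and images\<close>

text \<open>The j-th vector of the normalised basis of U; at the point U the operator theta is the
  action of this element of \<open>kE\<close>.\<close>

definition basis_vec :: "nat set \<Rightarrow> nat \<Rightarrow> ('e \<Rightarrow>\<^sub>0 'k) set \<Rightarrow> 'e \<Rightarrow>\<^sub>0 'k" where
  "basis_vec S j U = lin (\<lambda>i. Ycoord x n r S i j U)"

definition basis_prod :: "nat set \<Rightarrow> nat list \<Rightarrow> ('e \<Rightarrow>\<^sub>0 'k) set \<Rightarrow> 'e \<Rightarrow>\<^sub>0 'k" where
  "basis_prod S js U = prod_list (map (\<lambda>j. basis_vec S j U) js)"

lemma basis_prod_simps [simp]:
  "basis_prod S [] U = 1"
  "basis_prod S (j # js) U = basis_vec S j U * basis_prod S js U"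
  by (simp_all add: basis_prod_def)

lemma act_sum_kscale:
  "act (\<Sum>i\<in>I. kscale (*) (c i) (a i)) m = (\<Sum>i\<in>I. kscale act (c i) (act (a i) m))"
  by (simp add: M.scale_sum_left act_kscale_left)

lemma theta_eq: "theta act V x n r S j s = (\<lambda>U\<in>ch S. act (basis_vec S j U) (s U))"
  by (simp add: theta_def basis_vec_def lin_def act_sum_kscale)

text \<open>Successive actions on \<open>M\<close> multiply in \<open>kE\<close>. The empty
  composition returns s itself, without restricting it, hence the assumption that s is
  extensional.\<close>

lemma theta_prod_eq:
  assumes "s \<in> extensional (ch S)"
  shows "theta_prod act V x n r S js s = (\<lambda>U\<in>ch S. act (basis_prod S js U) (s U))"
proof (induction js)
  case Nil
  then show ?case using assms by (simp add: theta_prod_def extensional_restrict)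
next
  case (Cons j js)
  then show ?case
    by (simp add: theta_prod_def theta_eq restrict_def cong: if_cong)
qed

text \<open>The coordinates of a vector of \<open>U\<close> in the normalised basis for \<open>S'\<close> are its entries in \<open>S'\<close>.\<close>

lemma basis_vec_change:
  assumes S: "index_set S" "index_set S'" and U: "U \<in> ch S" "U \<in> ch S'" and j: "j < r"
  shows "basis_vec S j U = (\<Sum>k<r. kscale (*) (Ycoord x n r S (pick S' k) j U) (basis_vec S' k U))"
proof -
  have A: "rep S U \<in> carrier_mat n r" and A': "rep S' U \<in> carrier_mat n r"
    using rep_chart(1)[OF S(1) U(1)] rep_chart(1)[OF S(2) U(2)] by (simp_all add: full_rank_carrier)
  have "lin (\<lambda>i. rep S U $$ (i, j)) \<in> colspan x (rep S' U)"
    using column_in_colspan[OF A j] rep_chart(2)[OF S(1) U(1)] rep_chart(2)[OF S(2) U(2)] by simp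
  then obtain v where v: "lin (\<lambda>i. rep S U $$ (i, j)) = lin (\<lambda>i. \<Sum>k<r. rep S' U $$ (i, k) * v k)"
    unfolding colspan_eq[OF A'] by blast
  have "rep S U $$ (pick S' k, j) = v k" if k: "k < r" for k
  proof -
    have "pick S' k < n" using S(2) k pick_lt by (auto simp: index_set_def)
    then have "rep S U $$ (pick S' k, j) = (\<Sum>k'<r. rep S' U $$ (pick S' k, k') * v k')"
      using lin_inj[OF v] by simp
    also have "\<dots> = (\<Sum>k'<r. if k = k' then v k' else 0)"
      using rep_pick[OF S(2) U(2) k] by (intro sum.cong) auto
    also have "\<dots> = v k" using k by simp
    finally show ?thesis .
  qed
  then have "(\<Sum>k<r. kscale (*) (rep S U $$ (pick S' k, j)) (lin (\<lambda>i. rep S' U $$ (i, k)))) =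
      lin (\<lambda>i. rep S U $$ (i, j))"
    by (simp add: v flip: sum_lin)
  then show ?thesis by (simp add: basis_vec_def Ycoord_eq)
qed

text \<open>One factor from the basis for \<open>S\<close> is traded for a combination of factors
  from the basis for \<open>S'\<close>, and the commutativity of \<open>kE\<close> moves the new
  factor to the others for \<open>S'\<close>. Iterating it converts a whole product while the number
  of factors is constant.\<close>

lemma act_basis_prod_change:
  assumes S: "index_set S" "index_set S'" and U: "U \<in> ch S" "U \<in> ch S'" and j: "j < r"
  shows "act (basis_prod S (j # js) U * basis_prod S' ks U) m =
    (\<Sum>k<r. kscale act (Ycoord x n r S (pick S' k) j U) (act (basis_prod S js U * basis_prod S' (k # ks) U) m))"
proof -
  have "act (basis_prod S (j # js) U * basis_prod S' ks U) m = act (basis_vec S j U) (act (basis_prod S js U * basis_prod S' ks U) m)"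
    by (simp add: ac_simps)
  also have "\<dots> = (\<Sum>k<r. kscale act (Ycoord x n r S (pick S' k) j U)
      (act (basis_vec S' k U) (act (basis_prod S js U * basis_prod S' ks U) m)))"
    unfolding basis_vec_change[OF assms] act_sum_kscale ..
  finally show ?thesis by (simp add: ac_simps)
qed

lemma Ycoord_chart_ring:
  assumes "index_set S" "i < n" "j < r"
  shows "(\<lambda>U\<in>ch S. Ycoord x n r S i j U) \<in> cr S"
  using chart_ring_poly[OF assms(1) mat_poly_entry[OF assms(2,3)]] by (simp add: Ycoord_eq)

lemma regular_at_Ycoord:
  assumes S: "index_set S" "index_set S'" and U: "U \<in> ch S" "U \<in> ch S'" and "i < n" "j < r"
  shows "regular_at S' (Ycoord x n r S i j) U"
proof (rule regular_at_change[OF S _ U(2)])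
  show "regular_at S (Ycoord x n r S i j) U"
    by (rule regular_at_cong[OF S(1) regular_at_chart_ring[OF Ycoord_chart_ring[OF S(1) assms(5,6)] U(1)]
          gr_open_chart[OF S(1)] U(1)]) simp
qed

section \<open>The chart module is stable under the operators\<close>

lemma chart_submodule_sum:
  assumes N: "chart_submodule S N" and "\<And>i. i \<in> I \<Longrightarrow> s i \<in> N"
  shows "(\<lambda>U\<in>ch S. \<Sum>i\<in>I. s i U) \<in> N"
  using assms(2)
proof (induction I rule: infinite_finite_induct)
  case (insert i I)
  then have "(\<lambda>U\<in>ch S. s i U + (\<lambda>U\<in>ch S. \<Sum>i\<in>I. s i U) U) \<in> N"
    by (intro chart_submoduleD(3)[OF N]) auto
  also have "(\<lambda>U\<in>ch S. s i U + (\<lambda>U\<in>ch S. \<Sum>i\<in>I. s i U) U) = (\<lambda>U\<in>ch S. \<Sum>i\<in>insert i I. s i U)"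
    using insert by (auto simp: fun_eq_iff)
  finally show ?case .
qed (simp_all add: chart_submoduleD(2)[OF N])

lemma chart_module_act:
  assumes "s \<in> CM S"
  shows "(\<lambda>U\<in>ch S. act a (s U)) \<in> CM S"
proof -
  obtain N :: nat and f m where s: "s = (\<lambda>U\<in>ch S. \<Sum>t<N. kscale act (f t U) (m t))"
      "\<forall>t<N. f t \<in> cr S"
    using assms unfolding tensor_def by blast
  have "(\<lambda>U\<in>ch S. act a (s U)) = (\<lambda>U\<in>ch S. \<Sum>t<N. kscale act (f t U) (act a (m t)))"
    by (auto simp: s(1) M.scale_sum_right act_kscale)
  also have "\<dots> \<in> CM S" using s(2) by (intro tensor_sum_finite) auto
  finally show ?thesis .
qed

lemma chart_module_basis_vec:
  assumes S: "index_set S" and j: "j < r" and s: "s \<in> CM S"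
  shows "(\<lambda>U\<in>ch S. act (basis_vec S j U) (s U)) \<in> CM S"
proof -
  have "(\<lambda>U\<in>ch S. act (basis_vec S j U) (s U)) =
      (\<lambda>U\<in>ch S. \<Sum>i<n. (\<lambda>U\<in>ch S. kscale act ((\<lambda>U\<in>ch S. Ycoord x n r S i j U) U)
        ((\<lambda>U\<in>ch S. act (x i) (s U)) U)) U)"
    by (auto simp: basis_vec_def lin_def act_sum_kscale)
  also have "\<dots> \<in> CM S"
    by (intro chart_submodule_sum[OF chart_submodule_chart_module]
        chart_submoduleD(4)[OF chart_submodule_chart_module] Ycoord_chart_ring[OF S _ j]
        chart_module_act s) simp
  finally show ?thesis .
qed

lemma chart_module_basis_prod:
  assumes S: "index_set S" and js: "set js \<subseteq> {..<r}" and s: "s \<in> CM S"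
  shows "(\<lambda>U\<in>ch S. act (basis_prod S js U) (s U)) \<in> CM S"
  using js
proof (induction js)
  case Nil
  then show ?case using s extensional_restrict[OF tensor_extensional[OF s]] by simp
next
  case (Cons j js)
  then have "(\<lambda>U\<in>ch S. act (basis_vec S j U) ((\<lambda>U\<in>ch S. act (basis_prod S js U) (s U)) U)) \<in> CM S"
    by (intro chart_module_basis_vec[OF S]) auto
  then show ?case by (simp add: restrict_def cong: if_cong)
qed

section \<open>The kernel modules\<close>

lemma Ker_chart_iff:
  assumes "1 \<le> r"
  shows "s \<in> Ker_chart act V x n r l S \<longleftrightarrow> s \<in> CM S \<and>
    (\<forall>U\<in>ch S. \<forall>js\<in>tuples r l. act (basis_prod S js U) (s U) = 0)"
proof -
  \<comment> \<open>An intersection over no tuples would contain every function; since r is positive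
    a tuple exists, and membership in the chart module follows.\<close>
  have "replicate l 0 \<in> tuples r l" using assms by (auto simp: tuples_def)
  then have "s \<in> Ker_chart act V x n r l S \<longleftrightarrow> s \<in> CM S \<and>
      (\<forall>js\<in>tuples r l. theta_prod act V x n r S js s = (\<lambda>U\<in>ch S. 0))"
    unfolding Ker_chart_def by blast
  also have "\<dots> \<longleftrightarrow> s \<in> CM S \<and> (\<forall>js\<in>tuples r l. \<forall>U\<in>ch S. act (basis_prod S js U) (s U) = 0)"
  proof (intro conj_cong refl ball_cong)
    fix js assume "s \<in> CM S"
    show "theta_prod act V x n r S js s = (\<lambda>U\<in>ch S. 0) \<longleftrightarrow>
        (\<forall>U\<in>ch S. act (basis_prod S js U) (s U) = 0)"
      unfolding theta_prod_eq[OF tensor_extensional[OF \<open>s \<in> CM S\<close>]]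
      by (auto simp: fun_eq_iff)
  qed
  finally show ?thesis by blast
qed

lemma chart_submodule_Ker_chart:
  assumes r: "1 \<le> r"
  shows "chart_submodule S (Ker_chart act V x n r l S)"
  unfolding chart_submodule_def
  using chart_submoduleD(2-)[OF chart_submodule_chart_module]
  by (auto simp: Ker_chart_iff[OF r] M.scale_right_distrib act_kscale)

lemma act_basis_prod_zero_change:
  assumes S: "index_set S" "index_set S'" and U: "U \<in> ch S" "U \<in> ch S'"
    and m: "\<And>ks. ks \<in> tuples r l \<Longrightarrow> act (basis_prod S' ks U) m = 0"
    and js: "js \<in> tuples r l"
  shows "act (basis_prod S js U) m = 0"
proof -
  \<comment> \<open>Generalised to mixed products with l factors in all, so that the induction can
    move factors from \<open>S\<close> to \<open>S'\<close> one by one until the hypothesis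
    applies.\<close>
  have "act (basis_prod S js U * basis_prod S' ks U) m = 0"
    if "set js \<subseteq> {..<r}" "set ks \<subseteq> {..<r}" "length js + length ks = l" for js ks
    using that
  proof (induction js arbitrary: ks)
    case Nil
    then show ?case using m[of ks] by (simp add: tuples_def)
  next
    case (Cons j js)
    then have "act (basis_prod S js U * basis_prod S' (k # ks) U) m = 0" if "k < r" for k
      using that by (intro Cons.IH) auto
    then show ?case
      unfolding act_basis_prod_change[OF S U, of j js ks] using Cons.prems
      by (subst act_basis_prod_change[OF S U]) auto
  qed
  from this[of js "[]"] js show ?thesis by (simp add: tuples_def)
qed

lemma Ker_chart_change:
  assumes r: "1 \<le> r" and S: "index_set S" "index_set S'"
    and a: "a \<in> Ker_chart act V x n r l S" and U: "U \<in> ch S" "U \<in> ch S'"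
  shows "frac_at S' (Ker_chart act V x n r l S') a U"
proof -
  have a': "a \<in> CM S" "\<And>U js. U \<in> ch S \<Longrightarrow> js \<in> tuples r l \<Longrightarrow> act (basis_prod S js U) (a U) = 0"
    using a by (auto simp: Ker_chart_iff[OF r])
  obtain b h where b: "b \<in> CM S'" "h \<in> cr S'" "U \<in> basic_open S' h" "basic_open S' h \<subseteq> ch S"
    "\<And>U'. U' \<in> basic_open S' h \<Longrightarrow> a U' = kscale act (inverse (h U')) (b U')"
    by (rule frac_at_shrink[OF S(2) chart_submodule_chart_module
          frac_at_chart_module_change[OF S a'(1) U] gr_open_chart[OF S(1)] U(1)]) blast
  \<comment> \<open>Where h is nonzero, b is h times a, so c is the square of h times a; this is why
    the final denominator is h * h.\<close>
  define c where "c = (\<lambda>U\<in>ch S'. kscale act (h U) (b U))"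
  have "c \<in> Ker_chart act V x n r l S'"
    unfolding Ker_chart_iff[OF r]
  proof (intro conjI ballI)
    show "c \<in> CM S'"
      unfolding c_def by (rule chart_submoduleD(4)[OF chart_submodule_chart_module b(2,1)])
    fix U' js assume U': "U' \<in> ch S'" and js: "js \<in> tuples r l"
    show "act (basis_prod S' js U') (c U') = 0"
    proof (cases "h U' = 0")
      case True
      then show ?thesis by (simp add: c_def U')
    next
      case False
      then have h: "U' \<in> basic_open S' h" using U' by (simp add: basic_open_def)
      then have "U' \<in> ch S" using b(4) by blast
      then have "act (basis_prod S' js U') (a U') = 0"
        by (intro act_basis_prod_zero_change[OF S(2,1) U' _ a'(2) js])
      moreover have "c U' = kscale act (h U' * h U') (a U')"
        using False U' by (simp add: c_def b(5)[OF h])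
      ultimately show ?thesis by (simp add: act_kscale)
    qed
  qed
  moreover have "(\<lambda>U\<in>ch S'. h U * h U) \<in> cr S'" by (rule chart_ring_mult[OF b(2,2)])
  moreover have "U \<in> basic_open S' (\<lambda>U\<in>ch S'. h U * h U)" using b(3) by (simp add: basic_open_mult)
  moreover have "a U' = kscale act (inverse ((\<lambda>U\<in>ch S'. h U * h U) U')) (c U')"
    if "U' \<in> basic_open S' (\<lambda>U\<in>ch S'. h U * h U)" for U'
  proof -
    have h: "U' \<in> basic_open S' h" using that by (simp add: basic_open_mult)
    then have "U' \<in> ch S'" "h U' \<noteq> 0" by (simp_all add: basic_open_def)
    then show ?thesis by (simp add: b(5)[OF h] c_def)
  qed
  ultimately show ?thesis unfolding frac_at_def by blast
qed

section \<open>The image modules\<close>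

lemma Im_chart_iff:
  "s \<in> Im_chart act V x n r l S \<longleftrightarrow> (\<exists>t. (\<forall>js\<in>tuples r l. t js \<in> CM S) \<and>
     s = (\<lambda>U\<in>ch S. \<Sum>js\<in>tuples r l. act (basis_prod S js U) (t js U)))"
proof
  assume "s \<in> Im_chart act V x n r l S"
  then obtain u where u: "s = (\<lambda>U\<in>ch S. \<Sum>js\<in>tuples r l. u js U)"
      "\<forall>js\<in>tuples r l. u js \<in> theta_prod act V x n r S js ` CM S"
    unfolding Im_chart_def by blast
  then have "\<forall>js\<in>tuples r l. \<exists>t. t \<in> CM S \<and> u js = theta_prod act V x n r S js t" by blast
  then obtain t where t: "\<And>js. js \<in> tuples r l \<Longrightarrow> t js \<in> CM S"
      "\<And>js. js \<in> tuples r l \<Longrightarrow> u js = theta_prod act V x n r S js (t js)"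
    by metis
  have "s = (\<lambda>U\<in>ch S. \<Sum>js\<in>tuples r l. act (basis_prod S js U) (t js U))"
    unfolding u(1)
    by (intro restrict_ext sum.cong refl) (simp add: t(2) theta_prod_eq[OF tensor_extensional[OF t(1)]])
  with t(1) show "\<exists>t. (\<forall>js\<in>tuples r l. t js \<in> CM S) \<and>
     s = (\<lambda>U\<in>ch S. \<Sum>js\<in>tuples r l. act (basis_prod S js U) (t js U))" by blast
next
  assume "\<exists>t. (\<forall>js\<in>tuples r l. t js \<in> CM S) \<and>
     s = (\<lambda>U\<in>ch S. \<Sum>js\<in>tuples r l. act (basis_prod S js U) (t js U))"
  then obtain t where t: "\<And>js. js \<in> tuples r l \<Longrightarrow> t js \<in> CM S"
      "s = (\<lambda>U\<in>ch S. \<Sum>js\<in>tuples r l. act (basis_prod S js U) (t js U))" by blast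
  have "s = (\<lambda>U\<in>ch S. \<Sum>js\<in>tuples r l. theta_prod act V x n r S js (t js) U)"
    unfolding t(2)
    by (intro restrict_ext sum.cong refl) (simp add: theta_prod_eq[OF tensor_extensional[OF t(1)]])
  then show "s \<in> Im_chart act V x n r l S"
    unfolding Im_chart_def
    by (intro CollectI exI[of _ "\<lambda>js. theta_prod act V x n r S js (t js)"] conjI ballI imageI t(1))
qed

lemma finite_tuples: "finite (tuples r l)"
  unfolding tuples_def using finite_lists_length_eq[of "{..<r}" l] by (simp add: conj_commute)

lemma chart_submodule_Im_chart:
  assumes S: "index_set S"
  shows "chart_submodule S (Im_chart act V x n r l S)"
  unfolding chart_submodule_def
proof (intro conjI ballI subsetI)
  note CM = chart_submodule_chart_module[of S]
  fix s assume "s \<in> Im_chart act V x n r l S"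
  then obtain t where t: "\<And>js. js \<in> tuples r l \<Longrightarrow> t js \<in> CM S"
      "s = (\<lambda>U\<in>ch S. \<Sum>js\<in>tuples r l. act (basis_prod S js U) (t js U))"
    by (auto simp: Im_chart_iff)
  have "s = (\<lambda>U\<in>ch S. \<Sum>js\<in>tuples r l. (\<lambda>U\<in>ch S. act (basis_prod S js U) (t js U)) U)"
    by (auto simp: t(2))
  also have "\<dots> \<in> CM S"
    using t(1) by (intro chart_submodule_sum[OF CM] chart_module_basis_prod[OF S]) (auto simp: tuples_def)
  finally show "s \<in> CM S" .
  {
    fix s' assume "s' \<in> Im_chart act V x n r l S"
    then obtain t' where t': "\<And>js. js \<in> tuples r l \<Longrightarrow> t' js \<in> CM S"
        "s' = (\<lambda>U\<in>ch S. \<Sum>js\<in>tuples r l. act (basis_prod S js U) (t' js U))"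
      by (auto simp: Im_chart_iff)
    have "(\<lambda>U\<in>ch S. s U + s' U) =
        (\<lambda>U\<in>ch S. \<Sum>js\<in>tuples r l. act (basis_prod S js U) ((\<lambda>U\<in>ch S. t js U + t' js U) U))"
      by (auto simp: t(2) t'(2) M.scale_right_distrib sum.distrib)
    then show "(\<lambda>U\<in>ch S. s U + s' U) \<in> Im_chart act V x n r l S"
      unfolding Im_chart_iff using chart_submoduleD(3)[OF CM t(1) t'(1)]
      by (intro exI[of _ "\<lambda>js. \<lambda>U\<in>ch S. t js U + t' js U"]) simp
  }
  fix h assume h: "h \<in> cr S"
  have "(\<lambda>U\<in>ch S. kscale act (h U) (s U)) =
      (\<lambda>U\<in>ch S. \<Sum>js\<in>tuples r l. act (basis_prod S js U) ((\<lambda>U\<in>ch S. kscale act (h U) (t js U)) U))"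
    by (auto simp: t(2) act_kscale kM.scale_sum_right)
  then show "(\<lambda>U\<in>ch S. kscale act (h U) (s U)) \<in> Im_chart act V x n r l S"
    unfolding Im_chart_iff using chart_submoduleD(4)[OF CM h t(1)]
    by (intro exI[of _ "\<lambda>js. \<lambda>U\<in>ch S. kscale act (h U) (t js U)"]) simp
next
  have zero: "(\<lambda>U\<in>ch S. 0) = (\<lambda>U\<in>ch S. \<Sum>js\<in>tuples r l. act (basis_prod S js U) ((\<lambda>U\<in>ch S. 0) U))"
    by (auto simp: fun_eq_iff)
  show "(\<lambda>U\<in>ch S. 0) \<in> Im_chart act V x n r l S"
    unfolding Im_chart_iff
    by (intro exI[of _ "\<lambda>_. \<lambda>U\<in>ch S. 0"] conjI ballI zero
        chart_submoduleD(2)[OF chart_submodule_chart_module])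
qed

lemma act_basis_prod_Im_chart:
  assumes ks: "ks \<in> tuples r l" and b: "b \<in> CM S"
  shows "(\<lambda>U\<in>ch S. act (basis_prod S ks U) (b U)) \<in> Im_chart act V x n r l S"
proof -
  define t where "t js = (if js = ks then b else (\<lambda>U\<in>ch S. 0))" for js
  have "act (basis_prod S ks U) (b U) = (\<Sum>js\<in>tuples r l. act (basis_prod S js U) (t js U))"
    if U: "U \<in> ch S" for U
  proof -
    have "(\<Sum>js\<in>tuples r l. act (basis_prod S js U) (t js U)) =
        (\<Sum>js\<in>tuples r l. if js = ks then act (basis_prod S js U) (b U) else 0)"
      using U by (intro sum.cong) (auto simp: t_def)
    then show ?thesis using ks finite_tuples by simp
  qed
  then have "(\<lambda>U\<in>ch S. act (basis_prod S ks U) (b U)) =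
      (\<lambda>U\<in>ch S. \<Sum>js\<in>tuples r l. act (basis_prod S js U) (t js U))"
    by (intro restrict_ext)
  moreover have "t js \<in> CM S" for js
    using b chart_submoduleD(2)[OF chart_submodule_chart_module] by (simp add: t_def)
  ultimately show ?thesis unfolding Im_chart_iff by blast
qed

lemma Im_chart_change:
  assumes S: "index_set S" "index_set S'"
    and a: "a \<in> Im_chart act V x n r l S" and U: "U \<in> ch S" "U \<in> ch S'"
  shows "frac_at S' (Im_chart act V x n r l S') a U"
proof -
  let ?N = "Im_chart act V x n r l S'"
  note N = chart_submodule_Im_chart[OF S(2)]
  obtain t where t: "\<And>js. js \<in> tuples r l \<Longrightarrow> t js \<in> CM S"
      "a = (\<lambda>U\<in>ch S. \<Sum>js\<in>tuples r l. act (basis_prod S js U) (t js U))"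
    using a by (auto simp: Im_chart_iff)
  have UU: "U \<in> ch S \<inter> ch S'" using U by blast
  note op = gr_open_Int[OF gr_open_chart[OF S(1)] gr_open_chart[OF S(2)]]
  \<comment> \<open>Mixed products as in the kernel case, now applied to a section and read as germs
    in the image module for \<open>S'\<close>.\<close>
  have gen: "frac_at S' ?N (\<lambda>U. act (basis_prod S js U * basis_prod S' ks U) (u U)) U"
    if u: "u \<in> CM S" and "set js \<subseteq> {..<r}" "set ks \<subseteq> {..<r}" "length js + length ks = l" for u js ks
    using that(2-)
  proof (induction js arbitrary: ks)
    case Nil
    then have ks: "ks \<in> tuples r l" by (simp add: tuples_def)
    \<comment> \<open>All factors now belong to \<open>S'\<close>, but u is still a section over the
      chart of \<open>S\<close>. Written as b/h over \<open>S'\<close>, its scalar 1/h commutes with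
      the action, and the product applied to b is an element of the image.\<close>
    obtain b h where b: "b \<in> CM S'" "h \<in> cr S'" "U \<in> basic_open S' h"
        "\<And>U'. U' \<in> basic_open S' h \<Longrightarrow> u U' = kscale act (inverse (h U')) (b U')"
      using frac_at_chart_module_change[OF S u U] unfolding frac_at_def by blast
    have "act (basis_prod S [] U' * basis_prod S' ks U') (u U') =
        kscale act (inverse (h U')) ((\<lambda>U\<in>ch S'. act (basis_prod S' ks U) (b U)) U')"
      if "U' \<in> basic_open S' h" for U'
      using b(4)[OF that] that by (simp add: act_kscale basic_open_def)
    with act_basis_prod_Im_chart[OF ks b(1)] b(2,3) show ?case unfolding frac_at_def by blast
  next
    case (Cons j js)
    then have j: "j < r" by simp
    \<comment> \<open>The coefficients are coordinates of the chart of \<open>S\<close>;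
      \<open>regular_at_Ycoord\<close> makes them regular in the chart of \<open>S'\<close>, so each
      summand remains a fraction.\<close>
    have "frac_at S' ?N (\<lambda>U. \<Sum>k<r. kscale act (Ycoord x n r S (pick S' k) j U)
        (act (basis_prod S js U * basis_prod S' (k # ks) U) (u U))) U"
    proof (intro frac_at_sum[OF N U(2)] frac_at_scale[OF N] Cons.IH)
      fix k assume "k \<in> {..<r}"
      then show "regular_at S' (Ycoord x n r S (pick S' k) j) U"
        using S(2) pick_lt by (intro regular_at_Ycoord[OF S U _ j]) (auto simp: index_set_def)
    qed (use Cons.prems in auto)
    \<comment> \<open>The exchange formula needs both normalised bases, so the functions are
      compared on the overlap of the charts only.\<close>
    then show ?case
      by (rule frac_at_cong[OF S(2) N _ op UU])
        (use act_basis_prod_change[OF S _ _ j] in auto)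
  qed
  \<comment> \<open>The empty product for \<open>S'\<close> is the starting point, where all l
    factors still come from \<open>S\<close>.\<close>
  have "frac_at S' ?N (\<lambda>U. \<Sum>js\<in>tuples r l. act (basis_prod S js U * basis_prod S' [] U) (t js U)) U"
    by (intro frac_at_sum[OF N U(2)] gen t(1)) (auto simp: tuples_def)
  then show ?thesis
    by (rule frac_at_cong[OF S(2) N _ gr_open_chart[OF S(1)] U(1)]) (simp add: t(2))
qed

end

theorem proposition6p1:
  fixes act :: "('e::ab_group_add \<Rightarrow>\<^sub>0 'k::alg_closed_field) \<Rightarrow> 'm::ab_group_add \<Rightarrow> 'm"
    and V :: "('e \<Rightarrow>\<^sub>0 'k) set" and x :: "nat \<Rightarrow> 'e \<Rightarrow>\<^sub>0 'k" and p n r l :: nat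
  assumes char: "CHAR('k) = p" "p > 0"
    and E: "elementary_abelian TYPE('e) p n" "n \<ge> 1"
    and V: "rad_section V" "indexed_basis V n x"
    and M: "Modules.module act" "\<exists>B. finite_dimensional_vector_space (kscale act) B"
    and r: "1 \<le> r" "r \<le> n"
    and l: "1 \<le> l" "l \<le> r * (p - 1)"
  shows "(\<exists>!F. module_subsheaf act V x n r F \<and>
            (\<forall>S. S \<subseteq> {..<n} \<and> card S = r \<longrightarrow>
               restricts_to act V x n r F S (Ker_chart act V x n r l S))) \<and>
         (\<exists>!F. module_subsheaf act V x n r F \<and>
            (\<forall>S. S \<subseteq> {..<n} \<and> card S = r \<longrightarrow>
               restricts_to act V x n r F S (Im_chart act V x n r l S)))"
proof -
  interpret grassmannian_module V x n r act
    by (intro grassmannian_module.intro grassmannian.intro grassmannian_module_axioms.intro V(2) M(1))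
  obtain B where B: "finite_dimensional_vector_space (kscale act) B" using M(2) by blast
  show ?thesis
  proof
    show "\<exists>!F. module_subsheaf act V x n r F \<and> (\<forall>S. S \<subseteq> {..<n} \<and> card S = r \<longrightarrow>
        restricts_to act V x n r F S (Ker_chart act V x n r l S))"
      by (rule ex1_module_subsheaf[OF B chart_submodule_Ker_chart[OF r(1)] Ker_chart_change[OF r(1)]])
    show "\<exists>!F. module_subsheaf act V x n r F \<and> (\<forall>S. S \<subseteq> {..<n} \<and> card S = r \<longrightarrow>
        restricts_to act V x n r F S (Im_chart act V x n r l S))"
      by (rule ex1_module_subsheaf[OF B chart_submodule_Im_chart Im_chart_change])
  qed
qed

end
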